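(* Let $0<p<1$ and let $X$ be a solid FK-space satisfying $X\hookrightarrow H(\mathbb{D})$. Then $(H^{p,\infty},X)=X_{1/p-1}$.
   Context: $\mathbb{D}$ is the open unit disk, $\mathbb{T}$ its boundary, $m$ normalized Lebesgue measure on $\mathbb{T}$, $H(\mathbb{D})$ the analytic functions on $\mathbb{D}$ with the topology of uniform convergence on compact sets. $W$ is the space of complex sequences indexed by $\mathbb{N}_0=\{0,1,2,\dots\}$ with the topology of pointwise convergence; $f(z)=\sum a_nz^n\in H(\mathbb{D})$ is identified with $\{a_n\}\in W$. $X\hookrightarrow Y$ means $X\subset Y$ with continuous inclusion. An FK-space is an F-space (complete metrizable topological vector space) $X$ with $X\hookrightarrow W$. For vector subspaces $E,X$ of $W$, $(E,X)=\{\lambda\in W:\{\lambda_nw_n\}\in X\text{ for all }w\in E\}$. A vector subspace $X$ of $W$ is solid if $y\in X$ whenever $x\in X$, $y\in W$ and $|y_n|\le|x_n|$ for all $n$. For real $\alpha$ let $w_\alpha(0)=1$, $w_\alpha(n)=n^\alpha$ for $n\ge1$, and $X_\alpha=\{y\in W:\{w_\alpha(n)y_n\}\in X\}$. $H^{p,\infty}$: for measurable $f$ on $\mathbb{T}$ let $\lambda_f(s)=m(\{|f|>s\})$, $f^*(s)=\inf\{t\ge0:\lambda_f(t)\le s\}$. The Smirnov class $N^+$ consists of $f\in H(\mathbb{D})$ in the Nevanlinna class with $\lim_{r\to1^-}\int_{\mathbb{T}}\log^+|f(rz)|\,dm=\int_{\mathbb{T}}\log^+|f|\,dm$, where $f$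 on $\mathbb{T}$ is the nontangential boundary function. $H^{p,\infty}$ is the set of $f\in N^+$ with $\sup_{s>0}f^*(s)s^{1/p}<\infty$ for the boundary function. *)

theory Defs
  imports "HOL-Complex_Analysis.Complex_Analysis"
begin

definition W_topology :: "(nat \<Rightarrow> complex) topology" where
  "W_topology = product_topology (\<lambda>_. euclidean) UNIV"

definition seq_subspace :: "(nat \<Rightarrow> complex) set \<Rightarrow> bool" where
  "seq_subspace X \<longleftrightarrow>
     (\<lambda>_. 0) \<in> X \<and>
     (\<forall>x\<in>X. \<forall>y\<in>X. (\<lambda>n. x n + y n) \<in> X) \<and>
     (\<forall>c. \<forall>x\<in>X. (\<lambda>n. c * x n) \<in> X)"

definition seq_tvs :: "(nat \<Rightarrow> complex) topology \<Rightarrow> bool" where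
  "seq_tvs T \<longleftrightarrow>
     seq_subspace (topspace T) \<and>
     continuous_map (prod_topology T T) T (\<lambda>(x, y). \<lambda>n. x n + y n) \<and>
     continuous_map (prod_topology euclidean T) T (\<lambda>(c, x). \<lambda>n. c * x n)"

text \<open>As usual for F-spaces, completeness refers to a translation-invariant metric inducing
  the topology; such a metric is complete iff the topological vector space is.\<close>

definition F_space :: "(nat \<Rightarrow> complex) topology \<Rightarrow> bool" where
  "F_space T \<longleftrightarrow>
     seq_tvs T \<and>
     (\<exists>d. Metric_space (topspace T) d \<and>
          (\<forall>x\<in>topspace T. \<forall>y\<in>topspace T. \<forall>z\<in>topspace T.
             d (\<lambda>n. x n + z n) (\<lambda>n. y n + z n) = d x y) \<and>
          Metric_space.mcomplete (topspace T) d \<and>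
          T = Metric_space.mtopology (topspace T) d)"

definition cont_included ::
  "(nat \<Rightarrow> complex) topology \<Rightarrow> (nat \<Rightarrow> complex) topology \<Rightarrow> bool" (infix "\<hookrightarrow>" 50) where
  "S \<hookrightarrow> T \<longleftrightarrow> topspace S \<subseteq> topspace T \<and> continuous_map S T (\<lambda>x. x)"

definition FK_space :: "(nat \<Rightarrow> complex) set \<Rightarrow> (nat \<Rightarrow> complex) topology \<Rightarrow> bool" where
  "FK_space X T \<longleftrightarrow> topspace T = X \<and> F_space T \<and> T \<hookrightarrow> W_topology"

definition solid :: "(nat \<Rightarrow> complex) set \<Rightarrow> bool" where
  "solid X \<longleftrightarrow> (\<forall>x\<in>X. \<forall>y. (\<forall>n. norm (y n) \<le> norm (x n)) \<longrightarrow> y \<in> X)"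

definition multipliers ::
  "(nat \<Rightarrow> complex) set \<Rightarrow> (nat \<Rightarrow> complex) set \<Rightarrow> (nat \<Rightarrow> complex) set" where
  "multipliers E X = {l. \<forall>w\<in>E. (\<lambda>n. l n * w n) \<in> X}"

definition pow_weight :: "real \<Rightarrow> nat \<Rightarrow> real" where
  "pow_weight \<alpha> n = (if n = 0 then 1 else real n powr \<alpha>)"

definition weighted_space :: "(nat \<Rightarrow> complex) set \<Rightarrow> real \<Rightarrow> (nat \<Rightarrow> complex) set" where
  "weighted_space X \<alpha> = {y. (\<lambda>n. complex_of_real (pow_weight \<alpha> n) * y n) \<in> X}"

text \<open>The sequences identified with the members of a set of analytic functions on the disk.
  The values of these functions outside the open disk are irrelevant.\<close>

definition taylor_seqs :: "(complex \<Rightarrow> complex) set \<Rightarrow> (nat \<Rightarrow> complex) set" where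
  "taylor_seqs F = {a. \<exists>f\<in>F. \<forall>z\<in>ball 0 1. (\<lambda>n. a n * z ^ n) sums f z}"

definition H_disk :: "(complex \<Rightarrow> complex) set" where
  "H_disk = {f. f holomorphic_on ball 0 1}"

text \<open>Topology of uniform convergence on compact sets, transported to Taylor sequences.\<close>

definition H_disk_topology :: "(nat \<Rightarrow> complex) topology" where
  "H_disk_topology = topology_generated_by
     {{b \<in> taylor_seqs H_disk. \<forall>z\<in>K. norm ((\<Sum>n. b n * z ^ n) - (\<Sum>n. a n * z ^ n)) < e} | a K e.
        a \<in> taylor_seqs H_disk \<and> compact K \<and> K \<subseteq> ball 0 1 \<and> e > 0}"

text \<open>Normalized Lebesgue (not just Borel) measure on the unit circle.\<close>

definition circle_measure :: "complex measure" where
  "circle_measure = completion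
     (distr (uniform_measure lborel {0..2 * pi}) (restrict_space borel (sphere 0 1)) cis)"

text \<open>The Stolz region is empty for \<open>M \<le> 1\<close>.\<close>

definition stolz_region :: "real \<Rightarrow> complex \<Rightarrow> complex set" where
  "stolz_region M \<zeta> = {z \<in> ball 0 1. norm (z - \<zeta>) < M * (1 - norm z)}"

definition has_nt_limit :: "(complex \<Rightarrow> complex) \<Rightarrow> complex \<Rightarrow> complex \<Rightarrow> bool" where
  "has_nt_limit f \<zeta> L \<longleftrightarrow> (\<forall>M>1. (f \<longlongrightarrow> L) (at \<zeta> within stolz_region M \<zeta>))"

definition boundary_fun :: "(complex \<Rightarrow> complex) \<Rightarrow> complex \<Rightarrow> complex" where
  "boundary_fun f \<zeta> = (THE L. has_nt_limit f \<zeta> L)"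

definition log_plus :: "real \<Rightarrow> real" where
  "log_plus x = ln (max 1 x)"

definition nevanlinna :: "(complex \<Rightarrow> complex) set" where
  "nevanlinna = {f \<in> H_disk.
     (SUP r\<in>{0<..<1::real}.
        \<integral>\<^sup>+ \<zeta>. ennreal (log_plus (norm (f (of_real r * \<zeta>)))) \<partial>circle_measure) < \<infinity>}"

text \<open>Almost everywhere existence of nontangential limits holds throughout the Nevanlinna class
  by Fatou's theorem; the clause only records that \<^const>\<open>boundary_fun\<close> is meaningful.\<close>

definition smirnov :: "(complex \<Rightarrow> complex) set" where
  "smirnov = {f \<in> nevanlinna.
     (AE \<zeta> in circle_measure. \<exists>L. has_nt_limit f \<zeta> L) \<and>
     ((\<lambda>r::real. \<integral>\<^sup>+ \<zeta>. ennreal (log_plus (norm (f (of_real r * \<zeta>)))) \<partial>circle_measure)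
        \<longlongrightarrow> (\<integral>\<^sup>+ \<zeta>. ennreal (log_plus (norm (boundary_fun f \<zeta>))) \<partial>circle_measure)) (at_left 1)}"

definition distribution_fun :: "(complex \<Rightarrow> complex) \<Rightarrow> real \<Rightarrow> real" where
  "distribution_fun g s = measure circle_measure {\<zeta> \<in> sphere 0 1. norm (g \<zeta>) > s}"

text \<open>For measurable \<open>g\<close> and \<open>s > 0\<close> the set below is nonempty, the measure being finite.\<close>

definition decr_rearr :: "(complex \<Rightarrow> complex) \<Rightarrow> real \<Rightarrow> real" where
  "decr_rearr g s = Inf {t. t \<ge> 0 \<and> distribution_fun g t \<le> s}"

definition weak_hardy :: "real \<Rightarrow> (complex \<Rightarrow> complex) set" where
  "weak_hardy p = {f \<in> smirnov.
     bdd_above ((\<lambda>s. decr_rearr (boundary_fun f) s * s powr (1 / p)) ` {0<..})}"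

end

theory Submission
  imports Defs
begin

text \<open>Write \<open>\<alpha> = 1/p\<close>. Since \<open>X\<close> is a solid vector space, the equality follows from two facts about
the Taylor coefficients of functions in \<open>H\<^sup>p\<^sup>,\<^sup>\<infinity>\<close>: every such sequence is \<open>O(n powr (\<alpha> - 1))\<close>, and one
such sequence is bounded below by a positive multiple of \<open>n powr (\<alpha> - 1)\<close>. A multiplier is tested
on the second sequence; conversely the first fact dominates \<open>l n * a n\<close> by the weighted sequence.

The extremal sequence comes from \<open>(1 - z) powr (-\<alpha>)\<close>, whose boundary function has modulus
\<open>norm (1 - \<zeta>) powr (-\<alpha>)\<close> and so lies in weak \<open>L\<^sup>p\<close>. Its coefficients are
\<open>pochhammer \<alpha> n / fact n\<close>, which behave like \<open>n powr (\<alpha> - 1) / Gamma \<alpha>\<close>.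

For the upper bound let \<open>g\<close> be the modulus of the boundary function of \<open>f\<close> and let \<open>P\<close> denote the
Poisson integral. Subharmonicity of \<open>log\<^sup>+ |f|\<close> and the convergence of integrals in the definition
of the Smirnov class give \<open>log\<^sup>+ |f| \<le> P (log\<^sup>+ g)\<close> in the disk
(\<open>smirnov_log_plus_le\<close>). At a point of modulus \<open>r\<close>, cut \<open>g\<close> at the height
\<open>B = (1 - r) powr (-\<alpha>)\<close>: \<open>log\<^sup>+ g = log\<^sup>+ (min g B) + log\<^sup>+ (g / B)\<close>. The integral of the second term
is at most a constant times \<open>B powr (-p) = 1 - r\<close>, which compensates the bound \<open>2 / (1 - r)\<close> on the
Poisson kernel; so this term contributes a bounded factor to \<open>|f|\<close>. By Jensen's inequality the first
term contributes a factor of at most \<open>P (1 + min g B)\<close>. Integrating over the circle of radius \<open>r\<close> and using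
\<open>p < 1\<close>, the mean of \<open>|f|\<close> is at most a constant times \<open>B powr (1 - p) = (1 - r) powr (1 - \<alpha>)\<close>
(\<open>weak_hardy_integral_mean\<close>). Cauchy's estimate with \<open>r = n / (n + 1)\<close> finishes the proof.\<close>

section \<open>The measure on the unit circle\<close>

text \<open>The circle measure before completion. Integrals of functions measurable for it can be computed in
the parameter \<open>t \<mapsto> cis t\<close>.\<close>

definition borel_circle :: "complex measure" where
  "borel_circle = distr (uniform_measure lborel {0..2 * pi}) (restrict_space borel (sphere 0 1)) cis"

lemma circle_measure_completion: "circle_measure = completion borel_circle"
  by (simp add: circle_measure_def borel_circle_def)

lemma cis_measurable_circle [measurable]:
  "cis \<in> measurable (uniform_measure lborel {0..2 * pi}) (restrict_space borel (sphere 0 1))"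
proof -
  have "cis \<in> borel_measurable borel"
    by (intro borel_measurable_continuous_onI continuous_intros)
  then have "cis \<in> borel_measurable (uniform_measure lborel {0..2 * pi})"
    by (simp add: measurable_def uniform_measure_def)
  then show ?thesis
    by (intro measurable_restrict_space2) auto
qed

lemma space_circle_measure [simp]: "space circle_measure = sphere 0 1"
  by (simp add: circle_measure_completion borel_circle_def space_restrict_space)

lemma borel_measurable_circle_continuous:
  fixes h :: "complex \<Rightarrow> 'b::topological_space"
  assumes "continuous_on (sphere 0 1) h"
  shows "h \<in> borel_measurable borel_circle" "h \<in> borel_measurable circle_measure"
proof -
  have "h \<in> borel_measurable (restrict_space borel (sphere 0 1))"
    by (rule borel_measurable_continuous_on_restrict[OF assms])
  then show 1: "h \<in> borel_measurable borel_circle"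
    by (simp add: borel_circle_def)
  show "h \<in> borel_measurable circle_measure"
    unfolding circle_measure_completion by (rule measurable_completion[OF 1])
qed

lemma id_measurable_circle [measurable]: "(\<lambda>x. x) \<in> borel_measurable circle_measure"
  by (rule borel_measurable_circle_continuous) (intro continuous_intros)

lemma nn_integral_circle:
  assumes "h \<in> borel_measurable borel_circle"
  shows "(\<integral>\<^sup>+ \<zeta>. h \<zeta> \<partial>circle_measure) =
    (\<integral>\<^sup>+ t. h (cis t) * indicator {0..2*pi} t \<partial>lborel) / ennreal (2 * pi)"
proof -
  have h: "h \<in> borel_measurable (restrict_space borel (sphere 0 1))"
    using assms by (simp add: borel_circle_def)
  have hc: "(\<lambda>t. h (cis t)) \<in> borel_measurable (uniform_measure lborel {0..2 * pi})"
    using measurable_compose[OF cis_measurable_circle h] .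
  have "(\<integral>\<^sup>+ \<zeta>. h \<zeta> \<partial>circle_measure) = (\<integral>\<^sup>+ \<zeta>. h \<zeta> \<partial>borel_circle)"
    unfolding circle_measure_completion by (simp add: nn_integral_completion)
  also have "\<dots> = (\<integral>\<^sup>+ t. h (cis t) \<partial>uniform_measure lborel {0..2 * pi})"
    unfolding borel_circle_def by (rule nn_integral_distr[OF cis_measurable_circle]) (simp add: h)
  also have "\<dots> = (\<integral>\<^sup>+ t. h (cis t) * indicator {0..2*pi} t \<partial>lborel) / emeasure lborel {0..2*pi}"
    by (rule nn_integral_uniform_measure) (use hc in \<open>auto simp: measurable_def uniform_measure_def\<close>)
  finally show ?thesis by simp
qed

lemma emeasure_circle_measure: "emeasure circle_measure (sphere 0 1) = 1"
proof -
  have "emeasure circle_measure (sphere 0 1) = (\<integral>\<^sup>+ \<zeta>. 1 \<partial>circle_measure)"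
    by (simp flip: space_circle_measure)
  also have "\<dots> = 1"
    by (subst nn_integral_circle) (simp_all add: emeasure_lborel_Icc_eq divide_ennreal)
  finally show ?thesis .
qed

interpretation circle: finite_measure circle_measure
  by standard (simp add: emeasure_circle_measure)

interpretation circle: complete_measure circle_measure
  unfolding circle_measure_completion by (rule completion.complete_measure_axioms)

lemma integrable_circle_continuous:
  fixes h :: "complex \<Rightarrow> 'b::{banach, second_countable_topology}"
  assumes "continuous_on (sphere 0 1) h"
  shows "integrable circle_measure h"
proof -
  have "bounded (h ` sphere 0 1)"
    by (intro compact_imp_bounded compact_continuous_image assms compact_sphere)
  then obtain B where B: "\<And>x. x \<in> sphere 0 1 \<Longrightarrow> norm (h x) \<le> B"
    unfolding bounded_iff by blast
  show ?thesis
    by (rule circle.integrable_const_bound[of _ B])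
       (use B borel_measurable_circle_continuous[OF assms] in \<open>auto intro!: AE_I2\<close>)
qed

lemma circle_integral_has_integral:
  fixes h :: "complex \<Rightarrow> complex"
  assumes "continuous_on (sphere 0 1) h"
  shows "((\<lambda>t. h (cis t)) has_integral (of_real (2 * pi) * (\<integral>\<zeta>. h \<zeta> \<partial>circle_measure))) {0..2*pi}"
proof -
  have h: "h \<in> borel_measurable (restrict_space borel (sphere 0 1))"
    by (rule borel_measurable_continuous_on_restrict[OF assms])
  have c: "continuous_on {0..2*pi} (\<lambda>t. h (cis t))"
    by (rule continuous_on_compose2[OF assms]) (auto intro!: continuous_intros)
  have hc: "(\<lambda>t. h (cis t)) \<in> borel_measurable lborel"
    using measurable_compose[OF cis_measurable_circle h]
    by (auto simp: measurable_def uniform_measure_def)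
  have "(\<integral>\<zeta>. h \<zeta> \<partial>circle_measure) = (\<integral>\<zeta>. h \<zeta> \<partial>borel_circle)"
    unfolding circle_measure_completion
    by (rule integral_completion[OF borel_measurable_circle_continuous(1)[OF assms]])
  also have "\<dots> = (\<integral> t. h (cis t) \<partial>uniform_measure lborel {0..2 * pi})"
    unfolding borel_circle_def by (rule integral_distr[OF cis_measurable_circle h])
  also have "uniform_measure lborel {0..2 * pi} = density lborel (\<lambda>t. ennreal (indicator {0..2*pi} t / (2*pi)))"
    unfolding uniform_measure_def
    by (rule density_cong) (auto intro!: AE_I2 simp: divide_ennreal_def inverse_ennreal indicator_def field_simps)
  also have "(\<integral> t. h (cis t) \<partial>density lborel (\<lambda>t. ennreal (indicator {0..2*pi} t / (2*pi)))) =
      (\<integral> t. (indicator {0..2*pi} t / (2*pi)) *\<^sub>R h (cis t) \<partial>lborel)"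
    by (rule integral_density[OF hc]) (auto intro!: AE_I2)
  also have "\<dots> = (1 / (2*pi)) *\<^sub>R (LINT t:{0..2*pi}|lborel. h (cis t))"
  proof -
    have "(\<lambda>t. (indicator {0..2*pi} t / (2*pi)) *\<^sub>R h (cis t)) =
        (\<lambda>t. (1 / (2*pi)) *\<^sub>R (indicator {0..2*pi} t *\<^sub>R h (cis t)))"
      by (auto simp: fun_eq_iff indicator_def)
    then show ?thesis
      unfolding set_lebesgue_integral_def by (simp only: integral_scaleR_right)
  qed
  also have "(LINT t:{0..2*pi}|lborel. h (cis t)) = integral {0..2*pi} (\<lambda>t. h (cis t))"
    by (intro set_borel_integral_eq_integral borel_integrable_atLeastAtMost' c)
  finally have "of_real (2 * pi) * (\<integral>\<zeta>. h \<zeta> \<partial>circle_measure) = integral {0..2*pi} (\<lambda>t. h (cis t))"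
    by (simp add: scaleR_conv_of_real)
  then show ?thesis
    using integrable_continuous_real[OF c] by (simp add: has_integral_integrable_integral)
qed

text \<open>On the unit circle \<open>d\<zeta> = 2 * pi * \<i> * \<zeta> dm\<close>, so a contour integral of \<open>k\<close> is an integral of \<open>k \<zeta> * \<zeta>\<close>
against the circle measure. This is how Cauchy's formula enters.\<close>

lemma circle_contour_integral:
  fixes h :: "complex \<Rightarrow> complex"
  assumes "continuous_on (sphere 0 1) h"
    and I: "(k has_contour_integral I) (circlepath 0 1)"
    and k: "\<And>\<zeta>. \<zeta> \<in> sphere 0 1 \<Longrightarrow> k \<zeta> * \<zeta> = h \<zeta>"
  shows "I = 2 * of_real pi * \<i> * (\<integral>\<zeta>. h \<zeta> \<partial>circle_measure)"
proof -
  have "((\<lambda>t. k (0 + of_real 1 * cis t) * of_real 1 * \<i> * cis t) has_integral I) {0..2*pi}"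
    using I unfolding circlepath_def by (subst (asm) has_contour_integral_part_circlepath_iff) auto
  then have 1: "((\<lambda>t. \<i> * h (cis t)) has_integral I) {0..2*pi}"
    by (rule has_integral_eq[rotated]) (use k[of "cis _"] in \<open>simp add: algebra_simps\<close>)
  have 2: "((\<lambda>t. \<i> * h (cis t)) has_integral (\<i> * (of_real (2 * pi) * (\<integral>\<zeta>. h \<zeta> \<partial>circle_measure)))) {0..2*pi}"
    by (rule has_integral_mult_right[OF circle_integral_has_integral[OF assms(1)]])
  show ?thesis
    using has_integral_unique[OF 1 2] by (simp add: algebra_simps)
qed

section \<open>The Poisson kernel and subharmonicity\<close>

definition poisson_kernel :: "complex \<Rightarrow> complex \<Rightarrow> real" where
  "poisson_kernel z \<zeta> = (1 - (norm z)\<^sup>2) / (norm (\<zeta> - z))\<^sup>2"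

lemma continuous_on_poisson_kernel [continuous_intros]:
  assumes "norm z < 1" shows "continuous_on (sphere 0 1) (poisson_kernel z)"
  unfolding poisson_kernel_def using assms by (auto intro!: continuous_intros)

lemma poisson_kernel_nonneg: "norm z < 1 \<Longrightarrow> 0 \<le> poisson_kernel z \<zeta>"
  unfolding poisson_kernel_def by (simp add: abs_square_le_1)

lemma poisson_kernel_le:
  assumes "norm z < 1" "norm \<zeta> = 1"
  shows "poisson_kernel z \<zeta> \<le> 2 / (1 - norm z)"
proof -
  have "1 - norm z \<le> norm (\<zeta> - z)"
    using assms norm_triangle_ineq2[of \<zeta> z] by simp
  then have "(1 - norm z)\<^sup>2 \<le> (norm (\<zeta> - z))\<^sup>2"
    using assms by (intro power_mono) auto
  then have "poisson_kernel z \<zeta> \<le> (1 - (norm z)\<^sup>2) / (1 - norm z)\<^sup>2"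
    unfolding poisson_kernel_def using assms
    by (intro divide_left_mono mult_pos_pos zero_less_power) (auto simp: abs_square_le_1)
  also have "\<dots> = (1 + norm z) / (1 - norm z)"
  proof -
    have "1 - (norm z)\<^sup>2 = (1 - norm z) * (1 + norm z)"
      by (simp add: power2_eq_square algebra_simps)
    then show ?thesis using assms by (simp add: power2_eq_square)
  qed
  also have "\<dots> \<le> 2 / (1 - norm z)"
    using assms by (intro divide_right_mono) auto
  finally show ?thesis .
qed

text \<open>Both sides depend only on \<open>r\<close> and the angle between the two points. The symmetry makes the kernel
a probability density in its first argument as well, as needed when integrating over \<open>\<eta>\<close>.\<close>

lemma poisson_kernel_swap:
  assumes "norm \<eta> = 1" "norm \<zeta> = 1"
  shows "poisson_kernel (of_real r * \<eta>) \<zeta> = poisson_kernel (of_real r * \<zeta>) \<eta>"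
proof -
  have e: "(norm (x - of_real r * y))\<^sup>2 = 1 - 2 * r * (x \<bullet> y) + r\<^sup>2"
    if "norm x = 1" "norm y = 1" for x y :: complex
    unfolding power2_norm_eq_inner scaleR_conv_of_real[symmetric]
    using that by (simp add: inner_diff inner_commute power2_eq_square algebra_simps norm_eq_1)
  have "(norm (\<zeta> - of_real r * \<eta>))\<^sup>2 = (norm (\<eta> - of_real r * \<zeta>))\<^sup>2"
    using assms by (simp add: e inner_commute)
  then show ?thesis
    using assms by (simp add: poisson_kernel_def norm_mult)
qed

text \<open>Cauchy's formula at \<open>z\<close> for \<open>G w * (1 - (norm z)\<^sup>2) / (1 - cnj z * w)\<close>, which agrees with \<open>G\<close> at
\<open>w = z\<close>: on the unit circle the factor turns the Cauchy kernel into the Poisson kernel.\<close>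

lemma poisson_formula:
  assumes G: "continuous_on (cball 0 1) G" "G holomorphic_on ball 0 1" and z: "norm z < 1"
  shows "G z = (\<integral>\<zeta>. of_real (poisson_kernel z \<zeta>) * G \<zeta> \<partial>circle_measure)"
proof -
  define F where "F = (\<lambda>w. G w * of_real (1 - (norm z)\<^sup>2) / (1 - cnj z * w))"
  have nz: "1 - cnj z * w \<noteq> 0" if "norm w \<le> 1" for w
  proof
    assume "1 - cnj z * w = 0"
    then have "norm (cnj z * w) = 1" by simp
    moreover have "norm z * norm w \<le> norm z * 1" using that by (intro mult_left_mono) auto
    ultimately show False using z by (simp add: norm_mult)
  qed
  have "((\<lambda>u. F u/(u-z)) has_contour_integral (2 * of_real pi * \<i> * F z)) (circlepath 0 1)"
    by (rule Cauchy_integral_circlepath)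
       (use z nz in \<open>auto simp: F_def intro!: continuous_intros holomorphic_intros G\<close>)
  moreover have "continuous_on (sphere 0 1) (\<lambda>\<zeta>. of_real (poisson_kernel z \<zeta>) * G \<zeta>)"
    using z by (intro continuous_intros continuous_on_subset[OF G(1)]) auto
  moreover have "F \<zeta> / (\<zeta> - z) * \<zeta> = of_real (poisson_kernel z \<zeta>) * G \<zeta>" if "\<zeta> \<in> sphere 0 1" for \<zeta>
  proof -
    have "\<zeta> * cnj \<zeta> = 1" using that by (simp flip: complex_norm_square)
    then have "(\<zeta> - z) * (1 - cnj z * \<zeta>) = \<zeta> * ((\<zeta> - z) * cnj (\<zeta> - z))"
      by (simp add: algebra_simps)
    also have "\<dots> = \<zeta> * of_real ((norm (\<zeta> - z))\<^sup>2)"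
      by (simp only: complex_norm_square)
    finally have *: "(\<zeta> - z) * (1 - cnj z * \<zeta>) = \<zeta> * of_real ((norm (\<zeta> - z))\<^sup>2)" .
    have ne: "\<zeta> \<noteq> z" "\<zeta> \<noteq> 0" using that z by auto
    have "F \<zeta> / (\<zeta> - z) * \<zeta> = G \<zeta> * of_real (1 - (norm z)\<^sup>2) * \<zeta> / ((\<zeta> - z) * (1 - cnj z * \<zeta>))"
      by (simp add: F_def field_simps)
    also have "\<dots> = of_real (poisson_kernel z \<zeta>) * G \<zeta>"
      unfolding * using ne by (simp add: poisson_kernel_def field_simps)
    finally show ?thesis .
  qed
  ultimately have "2 * of_real pi * \<i> * F z =
      2 * of_real pi * \<i> * (\<integral>\<zeta>. of_real (poisson_kernel z \<zeta>) * G \<zeta> \<partial>circle_measure)"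
    by (intro circle_contour_integral)
  moreover have "F z = G z"
  proof -
    have "1 - cnj z * z = of_real (1 - (norm z)\<^sup>2)"
      using complex_norm_square[of z] by (simp add: mult.commute)
    then show ?thesis using nz[of z] z by (simp add: F_def)
  qed
  ultimately show ?thesis by simp
qed

lemma integral_poisson_kernel:
  assumes "norm z < 1" shows "(\<integral>\<zeta>. poisson_kernel z \<zeta> \<partial>circle_measure) = 1"
proof -
  have "(1::complex) = (\<integral>\<zeta>. of_real (poisson_kernel z \<zeta>) * 1 \<partial>circle_measure)"
    using poisson_formula[of "\<lambda>_. 1" z] assms by simp
  then have "(1::complex) = of_real (\<integral>\<zeta>. poisson_kernel z \<zeta> \<partial>circle_measure)" by simp
  then show ?thesis by (metis of_real_eq_1_iff)
qed

text \<open>On the circle \<open>cnj \<zeta>\<close> inverts \<open>\<zeta>\<close>, so the product is a trigonometric polynomial, and its negative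
frequencies can be reflected without changing the real part.\<close>

lemma Re_poly_mult_cnj:
  fixes p q :: "complex poly"
  shows "\<exists>r. \<forall>\<zeta>\<in>sphere 0 1. Re (poly p \<zeta> * cnj (poly q \<zeta>)) = Re (poly r \<zeta>)"
proof (induction p q rule: poly_induct2)
  case 0
  show ?case by (auto intro: exI[of _ 0])
next
  case (pCons a p b q)
  then obtain r where r: "\<And>\<zeta>. \<zeta> \<in> sphere 0 1 \<Longrightarrow> Re (poly p \<zeta> * cnj (poly q \<zeta>)) = Re (poly r \<zeta>)"
    by blast
  define s where "s = [:a * cnj b:] + pCons 0 (smult (cnj a) q) + pCons 0 (smult (cnj b) p) + r"
  have "Re (poly (pCons a p) \<zeta> * cnj (poly (pCons b q) \<zeta>)) = Re (poly s \<zeta>)" if "\<zeta> \<in> sphere 0 1" for \<zeta>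
  proof -
    have "\<zeta> * cnj \<zeta> = 1" using that by (simp flip: complex_norm_square)
    then have "poly (pCons a p) \<zeta> * cnj (poly (pCons b q) \<zeta>) =
        a * cnj b + cnj (\<zeta> * (cnj a * poly q \<zeta>)) + \<zeta> * (cnj b * poly p \<zeta>) + poly p \<zeta> * cnj (poly q \<zeta>)"
      by (simp add: algebra_simps)
    then have "Re (poly (pCons a p) \<zeta> * cnj (poly (pCons b q) \<zeta>)) =
        Re (a * cnj b) + Re (\<zeta> * (cnj a * poly q \<zeta>)) + Re (\<zeta> * (cnj b * poly p \<zeta>)) + Re (poly r \<zeta>)"
      using r[OF that] by (simp only: plus_complex.sel cnj.sel)
    then show ?thesis by (simp only: s_def poly_add poly_pCons poly_0 poly_smult plus_complex.sel zero_complex.sel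
        mult_zero_right add_0_left add_0_right)
  qed
  then show ?case by blast
qed

text \<open>Real parts of polynomials form an algebra on the circle, because
\<open>2 * Re a * Re b = Re (a * b) + Re (a * cnj b)\<close>; Stone--Weierstrass applies.\<close>

lemma Re_poly_dense:
  fixes \<phi> :: "complex \<Rightarrow> real"
  assumes "continuous_on (sphere 0 1) \<phi>" "e > 0"
  shows "\<exists>q::complex poly. \<forall>\<zeta>\<in>sphere 0 1. \<bar>\<phi> \<zeta> - Re (poly q \<zeta>)\<bar> < e"
proof -
  define R where "R = {\<psi>. \<exists>q::complex poly. \<forall>\<zeta>\<in>sphere 0 1. \<psi> \<zeta> = Re (poly q \<zeta>)}"
  interpret function_ring_on R "sphere 0 1"
  proof
    show "compact (sphere 0 (1::real) :: complex set)" by simp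
    show "continuous_on (sphere 0 1) f" if "f \<in> R" for f
    proof -
      from that obtain q :: "complex poly" where q: "\<forall>\<zeta>\<in>sphere 0 1. f \<zeta> = Re (poly q \<zeta>)"
        unfolding R_def by blast
      have "continuous_on (sphere 0 1) (\<lambda>\<zeta>. Re (poly q \<zeta>))" by (intro continuous_intros)
      then show ?thesis using q by (subst continuous_on_cong[OF refl]) auto
    qed
    show "(\<lambda>x. f x + g x) \<in> R" if "f \<in> R" "g \<in> R" for f g
      using that unfolding R_def
      by clarsimp (metis poly_add plus_complex.sel(1))
    show "(\<lambda>x. f x * g x) \<in> R" if "f \<in> R" "g \<in> R" for f g
    proof -
      from that obtain p q :: "complex poly" where pq: "\<forall>\<zeta>\<in>sphere 0 1. f \<zeta> = Re (poly p \<zeta>)"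
         "\<forall>\<zeta>\<in>sphere 0 1. g \<zeta> = Re (poly q \<zeta>)"
        unfolding R_def by blast
      obtain r where r: "\<forall>\<zeta>\<in>sphere 0 1. Re (poly p \<zeta> * cnj (poly q \<zeta>)) = Re (poly r \<zeta>)"
        using Re_poly_mult_cnj by blast
      have "f \<zeta> * g \<zeta> = Re (poly (smult (1/2) (p * q + r)) \<zeta>)" if "\<zeta> \<in> sphere 0 1" for \<zeta>
      proof -
        have "f \<zeta> * g \<zeta> = (Re (poly p \<zeta> * poly q \<zeta>) + Re (poly p \<zeta> * cnj (poly q \<zeta>))) / 2"
          using pq that by simp
        also have "Re (poly p \<zeta> * cnj (poly q \<zeta>)) = Re (poly r \<zeta>)"
          using r that by blast
        finally show ?thesis by simp
      qed
      then show ?thesis unfolding R_def by blast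
    qed
    show "(\<lambda>_. c) \<in> R" for c
      unfolding R_def by (auto intro!: exI[of _ "[:of_real c:]"])
    show "\<exists>f\<in>R. f x \<noteq> f y" if "x \<in> sphere 0 1" "y \<in> sphere 0 1" "x \<noteq> y" for x y
    proof (cases "Re x = Re y")
      case False
      have "Re \<in> R" unfolding R_def by (auto intro!: exI[of _ "[:0, 1:]"])
      with False show ?thesis by blast
    next
      case True
      have "Im \<in> R" unfolding R_def by (auto intro!: exI[of _ "[:0, -\<i>:]"])
      moreover have "Im x \<noteq> Im y" using True that(3) complex_eqI by blast
      ultimately show ?thesis by blast
    qed
  qed
  from Stone_Weierstrass_basic[OF assms] obtain g where "g \<in> R" "\<forall>x\<in>sphere 0 1. \<bar>\<phi> x - g x\<bar> < e"
    by blast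
  then show ?thesis unfolding R_def by force
qed

lemma log_plus_nonneg: "0 \<le> log_plus x" by (simp add: log_plus_def)

lemma log_plus_mono: "x \<le> y \<Longrightarrow> log_plus x \<le> log_plus y" by (simp add: log_plus_def)

lemma continuous_on_log_plus [continuous_intros]:
  "continuous_on S f \<Longrightarrow> continuous_on S (\<lambda>x. log_plus (f x))"
  unfolding log_plus_def by (intro continuous_intros) auto

lemma isCont_log_plus: "isCont log_plus x"
  using continuous_on_log_plus[of UNIV "\<lambda>x. x"] by (simp add: continuous_on_eq_continuous_at)

lemma le_exp_log_plus: "x \<le> exp (log_plus x)" by (simp add: log_plus_def)

lemma log_plus_le: "x \<le> exp y \<Longrightarrow> 0 \<le> y \<Longrightarrow> log_plus x \<le> y"
  unfolding log_plus_def by (metis exp_le_cancel_iff exp_ln exp_zero less_max_iff_disj max.bounded_iff zero_less_one)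

lemma log_plus_measurable [measurable]: "log_plus \<in> borel_measurable borel"
  unfolding log_plus_def by measurable

text \<open>Subharmonicity without harmonic functions: pick a polynomial \<open>q\<close> whose real part lies just above
\<open>log\<^sup>+ |F|\<close> on the circle. Then \<open>F * exp (- q)\<close> is bounded by \<open>1\<close> on the circle, hence at \<open>z\<close>, and
\<open>Re (q z)\<close> is the Poisson integral of its boundary values.\<close>

lemma log_plus_le_poisson_integral:
  assumes F: "continuous_on (cball 0 1) F" "F holomorphic_on ball 0 1" and z: "norm z < 1"
  shows "log_plus (norm (F z)) \<le> (\<integral>\<zeta>. poisson_kernel z \<zeta> * log_plus (norm (F \<zeta>)) \<partial>circle_measure)"
proof (rule log_plus_le)
  let ?\<phi> = "\<lambda>\<zeta>. log_plus (norm (F \<zeta>))"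
  have F': "continuous_on (sphere 0 1) F"
    by (rule continuous_on_subset[OF F(1)]) auto
  have ip: "integrable circle_measure (\<lambda>\<zeta>. poisson_kernel z \<zeta> * ?\<phi> \<zeta>)"
    "integrable circle_measure (poisson_kernel z)"
    by (intro integrable_circle_continuous continuous_intros z F')+
  show "0 \<le> (\<integral>\<zeta>. poisson_kernel z \<zeta> * ?\<phi> \<zeta> \<partial>circle_measure)"
    by (intro Bochner_Integration.integral_nonneg mult_nonneg_nonneg poisson_kernel_nonneg z log_plus_nonneg)
  have bound: "norm (F z) \<le> exp ((\<integral>\<zeta>. poisson_kernel z \<zeta> * ?\<phi> \<zeta> \<partial>circle_measure) + e)" if e0: "e > 0" for e
  proof -
    \<comment> \<open>Approximating \<open>?\<phi> + e/2\<close> to within \<open>e/2\<close> places the real part of \<open>q\<close> between \<open>?\<phi>\<close> and \<open>?\<phi> + e\<close>.\<close>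
    have "continuous_on (sphere 0 1) (\<lambda>\<zeta>. ?\<phi> \<zeta> + e/2)" by (intro continuous_intros F')
    then obtain q :: "complex poly" where q: "\<And>\<zeta>. \<zeta> \<in> sphere 0 1 \<Longrightarrow> \<bar>?\<phi> \<zeta> + e/2 - Re (poly q \<zeta>)\<bar> < e/2"
      using Re_poly_dense[of "\<lambda>\<zeta>. ?\<phi> \<zeta> + e/2" "e/2", OF _ half_gt_zero[OF e0]] by blast
    have "norm (F z * exp (- poly q z)) \<le> 1"
    proof (rule maximum_modulus_frontier[where S="cball 0 1" and f="\<lambda>z. F z * exp (- poly q z)" and \<xi>=z])
      show "(\<lambda>z. F z * exp (- poly q z)) holomorphic_on interior (cball 0 1)"
        using F by (auto intro!: holomorphic_intros)
      show "continuous_on (closure (cball 0 1)) (\<lambda>z. F z * exp (- poly q z))"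
        using F by (auto intro!: continuous_intros)
      fix \<zeta> assume "\<zeta> \<in> frontier (cball 0 (1::real) :: complex set)"
      then have \<zeta>: "\<zeta> \<in> sphere 0 1" by simp
      have "norm (F \<zeta> * exp (- poly q \<zeta>)) = norm (F \<zeta>) * exp (- Re (poly q \<zeta>))"
        by (simp add: norm_mult)
      also have "\<dots> \<le> exp (?\<phi> \<zeta>) * exp (- Re (poly q \<zeta>))"
        by (intro mult_right_mono le_exp_log_plus) auto
      also have "\<dots> \<le> 1"
      proof -
        have "?\<phi> \<zeta> \<le> Re (poly q \<zeta>)" using q[OF \<zeta>] by linarith
        then show ?thesis by (simp flip: exp_add)
      qed
      finally show "norm (F \<zeta> * exp (- poly q \<zeta>)) \<le> 1" .
    qed (use z in auto)
    then have le: "norm (F z) \<le> exp (Re (poly q z))"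
      by (simp add: norm_mult norm_divide exp_minus field_simps)
    have "poly q z = (\<integral>\<zeta>. of_real (poisson_kernel z \<zeta>) * poly q \<zeta> \<partial>circle_measure)"
      by (rule poisson_formula) (use z in \<open>auto intro!: continuous_intros holomorphic_intros\<close>)
    then have "Re (poly q z) = Re (\<integral>\<zeta>. of_real (poisson_kernel z \<zeta>) * poly q \<zeta> \<partial>circle_measure)"
      by simp
    also have "\<dots> = (\<integral>\<zeta>. Re (of_real (poisson_kernel z \<zeta>) * poly q \<zeta>) \<partial>circle_measure)"
      by (rule integral_Re[symmetric]) (intro integrable_circle_continuous continuous_intros z)
    also have "\<dots> \<le> (\<integral>\<zeta>. poisson_kernel z \<zeta> * ?\<phi> \<zeta> + poisson_kernel z \<zeta> * e \<partial>circle_measure)"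
    proof (rule integral_mono)
      show "integrable circle_measure (\<lambda>\<zeta>. Re (of_real (poisson_kernel z \<zeta>) * poly q \<zeta>))"
        by (intro integrable_circle_continuous continuous_intros z)
      show "integrable circle_measure (\<lambda>\<zeta>. poisson_kernel z \<zeta> * ?\<phi> \<zeta> + poisson_kernel z \<zeta> * e)"
        by (intro integrable_circle_continuous continuous_intros z F')
      fix \<zeta> assume "\<zeta> \<in> space circle_measure"
      then have "\<zeta> \<in> sphere 0 1" by simp
      then have "Re (poly q \<zeta>) \<le> ?\<phi> \<zeta> + e" using q[of \<zeta>] by linarith
      then have "poisson_kernel z \<zeta> * Re (poly q \<zeta>) \<le> poisson_kernel z \<zeta> * (?\<phi> \<zeta> + e)"
        by (intro mult_left_mono poisson_kernel_nonneg z)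
      then show "Re (of_real (poisson_kernel z \<zeta>) * poly q \<zeta>) \<le> poisson_kernel z \<zeta> * ?\<phi> \<zeta> + poisson_kernel z \<zeta> * e"
        by (simp add: distrib_left)
    qed
    also have "\<dots> = (\<integral>\<zeta>. poisson_kernel z \<zeta> * ?\<phi> \<zeta> \<partial>circle_measure) + e"
      using ip by (simp add: integral_poisson_kernel z)
    finally show ?thesis using le by (meson exp_le_cancel_iff order_trans)
  qed
  show "norm (F z) \<le> exp (\<integral>\<zeta>. poisson_kernel z \<zeta> * ?\<phi> \<zeta> \<partial>circle_measure)"
  proof (rule tendsto_lowerbound)
    show "((\<lambda>e. exp ((\<integral>\<zeta>. poisson_kernel z \<zeta> * ?\<phi> \<zeta> \<partial>circle_measure) + e)) \<longlongrightarrow>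
      exp (\<integral>\<zeta>. poisson_kernel z \<zeta> * ?\<phi> \<zeta> \<partial>circle_measure)) (at_right 0)"
      by (auto intro!: tendsto_eq_intros)
    show "\<forall>\<^sub>F e in at_right 0. norm (F z) \<le> exp ((\<integral>\<zeta>. poisson_kernel z \<zeta> * ?\<phi> \<zeta> \<partial>circle_measure) + e)"
      using eventually_at_right_less[of "0::real"]
      by eventually_elim (rule bound)
  qed simp
qed

section \<open>Integrals of weak-type functions\<close>

lemma nn_integral_layer_cake:
  fixes h :: "'a \<Rightarrow> real"
  assumes "sigma_finite_measure M" and [measurable]: "h \<in> borel_measurable M"
  shows "(\<integral>\<^sup>+ x. ennreal (h x) \<partial>M) =
    (\<integral>\<^sup>+ t. emeasure M {x \<in> space M. t < h x} * indicator {0<..} t \<partial>lborel)"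
proof -
  interpret M: sigma_finite_measure M by fact
  interpret pair_sigma_finite lborel M ..
  have "(\<integral>\<^sup>+ x. ennreal (h x) \<partial>M) = (\<integral>\<^sup>+ x. (\<integral>\<^sup>+ t. indicator {x \<in> space M. t < h x} x * indicator {0<..} t \<partial>lborel) \<partial>M)"
  proof (rule nn_integral_cong)
    fix x assume x: "x \<in> space M"
    have "(\<integral>\<^sup>+ t. indicator {x \<in> space M. t < h x} x * indicator {0<..} t \<partial>lborel) =
        (\<integral>\<^sup>+ t. indicator {0<..<h x} t \<partial>lborel)"
      using x by (intro nn_integral_cong) (auto simp: indicator_def)
    also have "\<dots> = emeasure lborel {0<..<h x}" by simp
    also have "\<dots> = ennreal (h x)"
      by (cases "0 \<le> h x") (auto simp: ennreal_neg)
    finally show "ennreal (h x) = (\<integral>\<^sup>+ t. indicator {x \<in> space M. t < h x} x * indicator {0<..} t \<partial>lborel)" ..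
  qed
  also have "\<dots> = (\<integral>\<^sup>+ t. (\<integral>\<^sup>+ x. indicator {x \<in> space M. t < h x} x * indicator {0<..} t \<partial>M) \<partial>lborel)"
  proof (rule Fubini')
    have "case_prod (\<lambda>t x. indicator {x \<in> space M. t < h x} x * indicator {0<..} t :: ennreal) \<in> borel_measurable (lborel \<Otimes>\<^sub>M M) \<longleftrightarrow>
      (\<lambda>p. indicator {p \<in> space (lborel \<Otimes>\<^sub>M M). fst p < h (snd p)} p * indicator {0<..} (fst p) :: ennreal) \<in> borel_measurable (lborel \<Otimes>\<^sub>M M)"
      by (intro measurable_cong) (auto simp: indicator_def space_pair_measure)
    also have "\<dots>" by measurable
    finally show "case_prod (\<lambda>t x. indicator {x \<in> space M. t < h x} x * indicator {0<..} t :: ennreal) \<in> borel_measurable (lborel \<Otimes>\<^sub>M M)" .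
  qed
  also have "\<dots> = (\<integral>\<^sup>+ t. emeasure M {x \<in> space M. t < h x} * indicator {0<..} t \<partial>lborel)"
    by (intro nn_integral_cong) (simp add: nn_integral_multc)
  finally show ?thesis .
qed

text \<open>Integrate the tail bound over the levels \<open>t < B\<close>; the integral converges at \<open>0\<close> because \<open>p < 1\<close>.\<close>

lemma weak_type_truncation:
  fixes g :: "'a \<Rightarrow> real"
  assumes M: "sigma_finite_measure M" and [measurable]: "g \<in> borel_measurable M"
    and g: "\<And>t. t > 0 \<Longrightarrow> emeasure M {x \<in> space M. t < g x} \<le> ennreal (C * t powr - p)"
    and p: "p < 1" and C: "0 \<le> C" and B: "0 < B"
  shows "(\<integral>\<^sup>+ x. ennreal (min (g x) B) \<partial>M) \<le> ennreal (C / (1 - p) * B powr (1 - p))"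
proof -
  have "(\<integral>\<^sup>+ x. ennreal (min (g x) B) \<partial>M) =
      (\<integral>\<^sup>+ t. emeasure M {x \<in> space M. t < min (g x) B} * indicator {0<..} t \<partial>lborel)"
    by (rule nn_integral_layer_cake[OF M]) measurable
  also have "\<dots> \<le> (\<integral>\<^sup>+ t. ennreal (C * t powr - p) * indicator {0..B} t \<partial>lborel)"
  proof (rule nn_integral_mono)
    fix t :: real
    show "emeasure M {x \<in> space M. t < min (g x) B} * indicator {0<..} t \<le>
        ennreal (C * t powr - p) * indicator {0..B} t"
      by (cases "t < B") (auto simp: indicator_def g)
  qed
  also have "\<dots> = ennreal (C * (B powr (- p + 1) / (- p + 1)))"
  proof (rule nn_integral_has_integral_lebesgue')
    show "((\<lambda>t. C * t powr - p) has_integral C * (B powr (- p + 1) / (- p + 1))) {0..B}"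
      by (intro has_integral_mult_right has_integral_powr_from_0) (use p B in auto)
  qed (use C in auto)
  finally show ?thesis by (simp add: algebra_simps)
qed

lemma less_log_plus_iff: "0 < t \<Longrightarrow> t < log_plus y \<longleftrightarrow> exp t < y"
proof -
  assume t: "0 < t"
  then have "t < log_plus y \<longleftrightarrow> exp t < max 1 y"
    unfolding log_plus_def by (subst exp_less_cancel_iff[symmetric]) simp
  then show ?thesis using t by (auto simp: less_max_iff_disj)
qed

text \<open>The level set of \<open>log_plus (g / B)\<close> at height \<open>t\<close> is that of \<open>g\<close> at \<open>B * exp t\<close>, so its measure
decays exponentially in \<open>t\<close>.\<close>

lemma weak_type_log_tail:
  fixes g :: "'a \<Rightarrow> real"
  assumes M: "sigma_finite_measure M" and [measurable]: "g \<in> borel_measurable M"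
    and g: "\<And>t. t > 0 \<Longrightarrow> emeasure M {x \<in> space M. t < g x} \<le> ennreal (C * t powr - p)"
    and p: "0 < p" and C: "0 \<le> C" and B: "0 < B"
  shows "(\<integral>\<^sup>+ x. ennreal (log_plus (g x / B)) \<partial>M) \<le> ennreal (C / p * B powr - p)"
proof -
  have "(\<integral>\<^sup>+ x. ennreal (log_plus (g x / B)) \<partial>M) =
      (\<integral>\<^sup>+ t. emeasure M {x \<in> space M. t < log_plus (g x / B)} * indicator {0<..} t \<partial>lborel)"
    by (rule nn_integral_layer_cake[OF M]) measurable
  also have "\<dots> \<le> (\<integral>\<^sup>+ t. ennreal (C * B powr - p * exp (- p * t)) * indicator {0..} t \<partial>lborel)"
  proof (rule nn_integral_mono)
    fix t :: real
    have "emeasure M {x \<in> space M. t < log_plus (g x / B)} \<le> ennreal (C * B powr - p * exp (- p * t))" if "t > 0"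
    proof -
      have "{x \<in> space M. t < log_plus (g x / B)} = {x \<in> space M. B * exp t < g x}"
        using that B by (auto simp: less_log_plus_iff field_simps)
      also have "emeasure M \<dots> \<le> ennreal (C * (B * exp t) powr - p)"
        using B by (intro g) simp
      also have "(B * exp t) powr - p = B powr - p * exp (- p * t)"
        using B by (simp add: powr_mult powr_def[of "exp t"])
      finally show ?thesis by (simp add: mult.assoc)
    qed
    then show "emeasure M {x \<in> space M. t < log_plus (g x / B)} * indicator {0<..} t \<le>
        ennreal (C * B powr - p * exp (- p * t)) * indicator {0..} t"
      by (auto simp: indicator_def)
  qed
  also have "\<dots> = ennreal (C * B powr - p * (exp (- p * 0) / p))"
  proof (rule nn_integral_has_integral_lebesgue')
    show "((\<lambda>t. C * B powr - p * exp (- p * t)) has_integral C * B powr - p * (exp (- p * 0) / p)) {0..}"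
      by (intro has_integral_mult_right has_integral_exp_minus_to_infinity p)
  qed (use C in auto)
  finally show ?thesis by (simp add: algebra_simps)
qed

text \<open>Jensen's inequality for the probability density \<open>w\<close>: integrate the tangent line of \<open>exp\<close> at the mean.\<close>

lemma exp_integral_le:
  fixes w u :: "'a \<Rightarrow> real"
  assumes w: "integrable M w" "\<And>x. x \<in> space M \<Longrightarrow> 0 \<le> w x" "(\<integral>x. w x \<partial>M) = 1"
    and wu: "integrable M (\<lambda>x. w x * u x)" and we: "integrable M (\<lambda>x. w x * exp (u x))"
  shows "exp (\<integral>x. w x * u x \<partial>M) \<le> (\<integral>x. w x * exp (u x) \<partial>M)"
proof -
  define m where "m = (\<integral>x. w x * u x \<partial>M)"
  \<comment> \<open>The tangent line at \<open>m\<close> is \<open>exp m * (1 + (y - m))\<close>, with mean \<open>exp m\<close>.\<close>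
  have "exp m = (\<integral>x. exp m * ((1 - m) * w x + w x * u x) \<partial>M)"
    using w wu by (simp add: m_def)
  also have "\<dots> \<le> (\<integral>x. w x * exp (u x) \<partial>M)"
  proof (rule integral_mono)
    show "integrable M (\<lambda>x. exp m * ((1 - m) * w x + w x * u x))" using w wu by simp
    fix x assume x: "x \<in> space M"
    have "exp m * (1 + (u x - m)) \<le> exp m * exp (u x - m)"
      by (intro mult_left_mono exp_ge_add_one_self) simp
    also have "\<dots> = exp (u x)" by (simp flip: exp_add)
    finally have "w x * (exp m * (1 + (u x - m))) \<le> w x * exp (u x)"
      using w(2)[OF x] by (rule mult_left_mono)
    then show "exp m * ((1 - m) * w x + w x * u x) \<le> w x * exp (u x)"
      by (simp add: algebra_simps)
  qed (rule we)
  finally show ?thesis by (simp add: m_def)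
qed

section \<open>Boundary values in the Smirnov class\<close>

text \<open>A radius runs inside every Stolz region of aperture \<open>M > 1\<close>. Hence a nontangential limit is a radial
limit, which gives uniqueness and measurability of the boundary function.\<close>

lemma radial_filterlim_stolz:
  assumes "norm \<zeta> = 1" "1 < M"
  shows "filterlim (\<lambda>r. of_real r * \<zeta>) (at \<zeta> within stolz_region M \<zeta>) (at_left (1::real))"
  unfolding filterlim_at
proof
  show "((\<lambda>r. of_real r * \<zeta>) \<longlongrightarrow> \<zeta>) (at_left (1::real))"
    by (auto intro!: tendsto_eq_intros)
  have "\<forall>\<^sub>F r in at_left (1::real). r \<in> {0<..<1}"
    by (rule eventually_at_leftI[of 0]) auto
  then show "\<forall>\<^sub>F r in at_left (1::real). of_real r * \<zeta> \<in> stolz_region M \<zeta> \<and> of_real r * \<zeta> \<noteq> \<zeta>"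
  proof eventually_elim
    case (elim r)
    have "of_real r * \<zeta> - \<zeta> = of_real (r - 1) * \<zeta>" by (simp add: algebra_simps)
    then have n: "norm (of_real r * \<zeta> - \<zeta>) = 1 - r"
      using elim assms by (simp only: norm_mult norm_of_real) simp
    have "1 - r < M * (1 - r)" using elim assms by simp
    moreover have "norm (of_real r * \<zeta>) = r" using elim assms by (simp add: norm_mult)
    moreover have "of_real r * \<zeta> \<noteq> \<zeta>" using n elim by auto
    ultimately show ?case
      using elim n by (simp add: stolz_region_def)
  qed
qed

lemma has_nt_limit_radial:
  assumes "has_nt_limit f \<zeta> L" "norm \<zeta> = 1"
  shows "((\<lambda>r. f (of_real r * \<zeta>)) \<longlongrightarrow> L) (at_left (1::real))"
proof -
  have "(f \<longlongrightarrow> L) (at \<zeta> within stolz_region 2 \<zeta>)"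
    using assms(1) by (simp add: has_nt_limit_def)
  from filterlim_compose[OF this radial_filterlim_stolz] show ?thesis
    using assms(2) by simp
qed

lemma boundary_fun_eqI:
  assumes "has_nt_limit f \<zeta> L" "norm \<zeta> = 1"
  shows "boundary_fun f \<zeta> = L"
  unfolding boundary_fun_def
proof (rule the_equality)
  fix L' assume "has_nt_limit f \<zeta> L'"
  from has_nt_limit_radial[OF this assms(2)] has_nt_limit_radial[OF assms]
  show "L' = L" by (rule tendsto_unique[rotated]) simp
qed fact

definition radius_seq :: "nat \<Rightarrow> real" where "radius_seq k = 1 - 1 / (real k + 2)"

lemma radius_seq_bounds: "0 < radius_seq k" "radius_seq k < 1"
  by (simp_all add: radius_seq_def field_simps)

lemma radius_seq_tendsto: "filterlim radius_seq (at_left 1) sequentially"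
  unfolding filterlim_at
proof
  have "(\<lambda>k. 1 - 1 / (real k + 2)) \<longlonglongrightarrow> 1 - 0"
    using LIMSEQ_ignore_initial_segment[OF lim_const_over_n[of "1::real"], of 2]
    by (intro tendsto_diff tendsto_const) (simp add: add.commute)
  then show "radius_seq \<longlonglongrightarrow> 1" by (simp add: radius_seq_def[abs_def])
qed (simp add: radius_seq_bounds less_imp_neq)

lemma continuous_on_dilation:
  assumes "f holomorphic_on ball 0 1" "0 \<le> r" "r < 1"
  shows "continuous_on (cball 0 1) (\<lambda>z. f (of_real r * z))"
    and "(\<lambda>z. f (of_real r * z)) holomorphic_on ball 0 1"
    and "continuous_on (sphere 0 1) (\<lambda>z. f (of_real r * z))"
proof -
  have r: "r * norm z < 1" if "norm z \<le> 1" for z :: complex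
    using assms that mult_left_mono[of "norm z" 1 r] by simp
  show 1: "continuous_on (cball 0 1) (\<lambda>z. f (of_real r * z))"
    by (rule continuous_on_compose2[OF holomorphic_on_imp_continuous_on[OF assms(1)]])
       (use r assms in \<open>auto simp: norm_mult intro!: continuous_intros\<close>)
  show "(\<lambda>z. f (of_real r * z)) holomorphic_on ball 0 1"
    by (rule holomorphic_on_compose_gen[OF _ assms(1), unfolded o_def])
       (use r assms in \<open>auto simp: norm_mult intro!: holomorphic_intros\<close>)
  show "continuous_on (sphere 0 1) (\<lambda>z. f (of_real r * z))"
    by (rule continuous_on_subset[OF 1]) auto
qed

lemma (in complete_measure) borel_measurable_AE_cong:
  fixes f g :: "'a \<Rightarrow> 'b::topological_space"
  assumes f: "f \<in> borel_measurable M" and ae: "AE x in M. f x = g x"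
  shows "g \<in> borel_measurable M"
proof (rule measurableI)
  fix A :: "'b set" assume "A \<in> sets borel"
  then have "f -` A \<inter> space M \<in> sets M" using f by (rule measurable_sets[rotated])
  moreover have "AE x in M. x \<in> f -` A \<inter> space M \<longleftrightarrow> x \<in> g -` A \<inter> space M"
    using ae by eventually_elim auto
  ultimately show "g -` A \<inter> space M \<in> sets M"
    using in_sets_AE by blast
qed auto

text \<open>The boundary function agrees almost everywhere with a pointwise limit of continuous functions; it is
measurable because the circle measure is complete.\<close>

lemma smirnov_boundary:
  assumes "f \<in> smirnov"
  shows "AE \<zeta> in circle_measure. (\<lambda>k. f (of_real (radius_seq k) * \<zeta>)) \<longlonglongrightarrow> boundary_fun f \<zeta>"
    and "boundary_fun f \<in> borel_measurable circle_measure"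
proof -
  have h: "f holomorphic_on ball 0 1" using assms by (simp add: smirnov_def nevanlinna_def H_disk_def)
  have "AE \<zeta> in circle_measure. \<exists>L. has_nt_limit f \<zeta> L" using assms by (simp add: smirnov_def)
  moreover have "AE \<zeta> in circle_measure. \<zeta> \<in> sphere 0 1" by (rule AE_I2) simp
  ultimately show 1: "AE \<zeta> in circle_measure. (\<lambda>k. f (of_real (radius_seq k) * \<zeta>)) \<longlonglongrightarrow> boundary_fun f \<zeta>"
  proof eventually_elim
    case (elim \<zeta>)
    then obtain L where L: "has_nt_limit f \<zeta> L" by blast
    show ?case
      using filterlim_compose[OF has_nt_limit_radial[OF L] radius_seq_tendsto] boundary_fun_eqI[OF L] elim by simp
  qed
  have [measurable]: "(\<lambda>\<zeta>. f (of_real (radius_seq k) * \<zeta>)) \<in> borel_measurable circle_measure" for k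
    using radius_seq_bounds[of k]
    by (intro borel_measurable_circle_continuous(2) continuous_on_dilation(3)[OF h]) auto
  show "boundary_fun f \<in> borel_measurable circle_measure"
  proof (rule circle.borel_measurable_AE_cong)
    show "(\<lambda>\<zeta>. lim (\<lambda>k. f (of_real (radius_seq k) * \<zeta>))) \<in> borel_measurable circle_measure" by measurable
    show "AE \<zeta> in circle_measure. lim (\<lambda>k. f (of_real (radius_seq k) * \<zeta>)) = boundary_fun f \<zeta>"
      using 1 by eventually_elim (rule limI)
  qed
qed

lemma integrable_bounded_mult_circle:
  fixes w u :: "complex \<Rightarrow> real"
  assumes [measurable]: "w \<in> borel_measurable circle_measure" and u: "integrable circle_measure u"
    and w: "\<And>\<zeta>. \<zeta> \<in> sphere 0 1 \<Longrightarrow> \<bar>w \<zeta>\<bar> \<le> B"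
  shows "integrable circle_measure (\<lambda>\<zeta>. w \<zeta> * u \<zeta>)"
proof (rule Bochner_Integration.integrable_bound)
  show "integrable circle_measure (\<lambda>\<zeta>. B * u \<zeta>)" using u by simp
  show "AE \<zeta> in circle_measure. norm (w \<zeta> * u \<zeta>) \<le> norm (B * u \<zeta>)"
  proof (rule AE_I2)
    fix \<zeta> assume "\<zeta> \<in> space circle_measure"
    then have "\<bar>w \<zeta>\<bar> \<le> \<bar>B\<bar>" using w[of \<zeta>] by simp
    then show "norm (w \<zeta> * u \<zeta>) \<le> norm (B * u \<zeta>)"
      unfolding real_norm_def abs_mult by (rule mult_right_mono) simp
  qed
  show "(\<lambda>\<zeta>. w \<zeta> * u \<zeta>) \<in> borel_measurable circle_measure" using u by measurable
qed

text \<open>The dilations \<open>f (r * z)\<close> satisfy the inequality by subharmonicity. As \<open>r\<close> tends to \<open>1\<close>, their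
\<open>log\<^sup>+\<close> converges almost everywhere on the circle, and by definition of the Smirnov class so do the
integrals. Scheffe's lemma upgrades this to convergence in \<open>L\<^sup>1\<close>, which survives multiplication by the
bounded Poisson kernel.\<close>

lemma smirnov_log_plus_le:
  assumes f: "f \<in> smirnov" and int: "integrable circle_measure (\<lambda>\<zeta>. log_plus (norm (boundary_fun f \<zeta>)))"
    and z: "norm z < 1"
  shows "log_plus (norm (f z)) \<le> (\<integral>\<zeta>. poisson_kernel z \<zeta> * log_plus (norm (boundary_fun f \<zeta>)) \<partial>circle_measure)"
proof -
  define \<phi> where "\<phi> = (\<lambda>\<zeta>. log_plus (norm (boundary_fun f \<zeta>)))"
  define F where "F = (\<lambda>k \<zeta>. log_plus (norm (f (of_real (radius_seq k) * \<zeta>))))"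
  have h: "f holomorphic_on ball 0 1" using f by (simp add: smirnov_def nevanlinna_def H_disk_def)
  note [measurable] = smirnov_boundary(2)[OF f]
  have contF: "continuous_on (sphere 0 1) (F k)" for k
    unfolding F_def using radius_seq_bounds[of k]
    by (intro continuous_intros continuous_on_dilation(3)[OF h]) auto
  have intF: "integrable circle_measure (F k)" for k
    by (rule integrable_circle_continuous[OF contF])
  have lim: "(\<lambda>k. \<integral>\<^sup>+ \<zeta>. norm (F k \<zeta> - \<phi> \<zeta>) \<partial>circle_measure) \<longlonglongrightarrow> 0"
  proof (rule Scheffe_lemma1)
    show "AE \<zeta> in circle_measure. (\<lambda>k. F k \<zeta>) \<longlonglongrightarrow> \<phi> \<zeta>"
      using smirnov_boundary(1)[OF f] unfolding F_def \<phi>_def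
      by eventually_elim (intro isCont_tendsto_compose[OF isCont_log_plus] tendsto_norm)
    have "((\<lambda>r::real. \<integral>\<^sup>+ \<zeta>. ennreal (log_plus (norm (f (of_real r * \<zeta>)))) \<partial>circle_measure)
        \<longlongrightarrow> (\<integral>\<^sup>+ \<zeta>. ennreal (log_plus (norm (boundary_fun f \<zeta>))) \<partial>circle_measure)) (at_left 1)"
      using f by (simp add: smirnov_def)
    from filterlim_compose[OF this radius_seq_tendsto]
    have "(\<lambda>k. \<integral>\<^sup>+ \<zeta>. norm (F k \<zeta>) \<partial>circle_measure) \<longlonglongrightarrow> (\<integral>\<^sup>+ \<zeta>. norm (\<phi> \<zeta>) \<partial>circle_measure)"
      by (simp add: F_def \<phi>_def log_plus_nonneg)
    then show "limsup (\<lambda>k. \<integral>\<^sup>+ \<zeta>. norm (F k \<zeta>) \<partial>circle_measure) \<le> (\<integral>\<^sup>+ \<zeta>. norm (\<phi> \<zeta>) \<partial>circle_measure)"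
      by (simp add: lim_imp_Limsup)
  qed (use intF int in \<open>auto simp: \<phi>_def\<close>)
  have P: "norm (poisson_kernel z \<zeta>) \<le> 2 / (1 - norm z)" if "\<zeta> \<in> space circle_measure" for \<zeta>
    using that poisson_kernel_le[OF z] poisson_kernel_nonneg[OF z] by simp
  have [measurable]: "poisson_kernel z \<in> borel_measurable circle_measure"
    by (intro borel_measurable_circle_continuous continuous_intros z)
  note iP = integrable_bounded_mult_circle[of "poisson_kernel z", OF _ _ P[unfolded real_norm_def space_circle_measure]]
  have "(\<lambda>k. (\<integral>\<zeta>. poisson_kernel z \<zeta> * F k \<zeta> \<partial>circle_measure)) \<longlonglongrightarrow> (\<integral>\<zeta>. poisson_kernel z \<zeta> * \<phi> \<zeta> \<partial>circle_measure)"
  proof (rule tendsto_L1_int)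
    show "\<And>k. integrable circle_measure (\<lambda>\<zeta>. poisson_kernel z \<zeta> * F k \<zeta>)" by (rule iP) (use intF in auto)
    show "integrable circle_measure (\<lambda>\<zeta>. poisson_kernel z \<zeta> * \<phi> \<zeta>)" by (rule iP) (use int in \<open>auto simp: \<phi>_def\<close>)
    have "(\<lambda>k. ennreal (2 / (1 - norm z)) * (\<integral>\<^sup>+ \<zeta>. norm (F k \<zeta> - \<phi> \<zeta>) \<partial>circle_measure)) \<longlonglongrightarrow> ennreal (2 / (1 - norm z)) * 0"
      by (intro ennreal_tendsto_cmult lim) simp
    then have *: "(\<lambda>k. ennreal (2 / (1 - norm z)) * (\<integral>\<^sup>+ \<zeta>. norm (F k \<zeta> - \<phi> \<zeta>) \<partial>circle_measure)) \<longlonglongrightarrow> 0"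
      by simp
    show "(\<lambda>k. \<integral>\<^sup>+ \<zeta>. norm (poisson_kernel z \<zeta> * F k \<zeta> - poisson_kernel z \<zeta> * \<phi> \<zeta>) \<partial>circle_measure) \<longlonglongrightarrow> 0"
    proof (rule tendsto_sandwich[OF _ _ tendsto_const *])
      show "\<forall>\<^sub>F k in sequentially. (\<integral>\<^sup>+ \<zeta>. norm (poisson_kernel z \<zeta> * F k \<zeta> - poisson_kernel z \<zeta> * \<phi> \<zeta>) \<partial>circle_measure)
        \<le> ennreal (2 / (1 - norm z)) * (\<integral>\<^sup>+ \<zeta>. norm (F k \<zeta> - \<phi> \<zeta>) \<partial>circle_measure)"
      proof (rule always_eventually, rule allI)
        fix k
        have [measurable]: "F k \<in> borel_measurable circle_measure" using intF by simp
        have "(\<integral>\<^sup>+ \<zeta>. norm (poisson_kernel z \<zeta> * F k \<zeta> - poisson_kernel z \<zeta> * \<phi> \<zeta>) \<partial>circle_measure) \<le>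
          (\<integral>\<^sup>+ \<zeta>. ennreal (2 / (1 - norm z)) * norm (F k \<zeta> - \<phi> \<zeta>) \<partial>circle_measure)"
        proof (rule nn_integral_mono)
          fix \<zeta> assume \<zeta>: "\<zeta> \<in> space circle_measure"
          have "norm (poisson_kernel z \<zeta> * F k \<zeta> - poisson_kernel z \<zeta> * \<phi> \<zeta>) = norm (poisson_kernel z \<zeta>) * norm (F k \<zeta> - \<phi> \<zeta>)"
            by (simp add: abs_mult flip: right_diff_distrib)
          also have "\<dots> \<le> 2 / (1 - norm z) * norm (F k \<zeta> - \<phi> \<zeta>)"
            by (intro mult_right_mono P \<zeta>) auto
          finally show "ennreal (norm (poisson_kernel z \<zeta> * F k \<zeta> - poisson_kernel z \<zeta> * \<phi> \<zeta>)) \<le>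
              ennreal (2 / (1 - norm z)) * norm (F k \<zeta> - \<phi> \<zeta>)"
            using z by (simp flip: ennreal_mult'')
        qed
        also have "\<dots> = ennreal (2 / (1 - norm z)) * (\<integral>\<^sup>+ \<zeta>. norm (F k \<zeta> - \<phi> \<zeta>) \<partial>circle_measure)"
          by (rule nn_integral_cmult) (simp add: \<phi>_def)
        finally show "(\<integral>\<^sup>+ \<zeta>. norm (poisson_kernel z \<zeta> * F k \<zeta> - poisson_kernel z \<zeta> * \<phi> \<zeta>) \<partial>circle_measure)
        \<le> ennreal (2 / (1 - norm z)) * (\<integral>\<^sup>+ \<zeta>. norm (F k \<zeta> - \<phi> \<zeta>) \<partial>circle_measure)" .
      qed
    qed simp
  qed
  moreover have "(\<lambda>k. log_plus (norm (f (of_real (radius_seq k) * z)))) \<longlonglongrightarrow> log_plus (norm (f z))"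
  proof -
    have "((\<lambda>k. of_real (radius_seq k) * z) \<longlonglongrightarrow> of_real 1 * z)"
      using radius_seq_tendsto by (intro tendsto_intros) (simp add: filterlim_at)
    moreover have "isCont f z"
      using continuous_on_interior[OF holomorphic_on_imp_continuous_on[OF h], of z] z by simp
    ultimately show ?thesis
      by (intro isCont_tendsto_compose[OF isCont_log_plus] tendsto_norm isCont_tendsto_compose[of _ f]) auto
  qed
  moreover have "log_plus (norm (f (of_real (radius_seq k) * z))) \<le> (\<integral>\<zeta>. poisson_kernel z \<zeta> * F k \<zeta> \<partial>circle_measure)" for k
    unfolding F_def using radius_seq_bounds[of k]
    by (intro log_plus_le_poisson_integral[where F="\<lambda>w. f (of_real (radius_seq k) * w)"] continuous_on_dilation h z) auto
  ultimately show ?thesis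
    unfolding \<phi>_def by (intro LIMSEQ_le) auto
qed

section \<open>Integral means and Taylor coefficients\<close>

text \<open>The bound on the decreasing rearrangement, rewritten as a bound on the distribution function, of
which the rearrangement is the generalized inverse.\<close>

lemma weak_hardy_distribution:
  assumes f: "f \<in> weak_hardy p" and p: "0 < p"
  obtains C where "0 \<le> C"
    and "\<And>t. t > 0 \<Longrightarrow> emeasure circle_measure {\<zeta> \<in> space circle_measure. t < norm (boundary_fun f \<zeta>)} \<le> ennreal (C * t powr - p)"
proof -
  define D where "D = distribution_fun (boundary_fun f)"
  have "f \<in> smirnov" using f by (simp add: weak_hardy_def)
  note [measurable] = smirnov_boundary(2)[OF this]
  obtain K where K: "\<And>s. s > 0 \<Longrightarrow> decr_rearr (boundary_fun f) s * s powr (1/p) \<le> K"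
    using f unfolding weak_hardy_def bdd_above_def by auto
  define K0 where "K0 = max K 1"
  have K0: "0 < K0" "K \<le> K0" by (auto simp: K0_def)
  have D_eq: "D t = measure circle_measure {\<zeta> \<in> space circle_measure. t < norm (boundary_fun f \<zeta>)}" for t
    by (simp add: D_def distribution_fun_def)
  have sets: "{\<zeta> \<in> space circle_measure. t < norm (boundary_fun f \<zeta>)} \<in> sets circle_measure" for t
    by measurable
  have D_mono: "D t \<le> D t'" if "t' \<le> t" for t t'
    unfolding D_eq using that by (intro circle.finite_measure_mono sets) auto
  have D_lim: "(\<lambda>n. D (real n)) \<longlonglongrightarrow> 0"
  proof -
    define A where "A = (\<lambda>n. {\<zeta> \<in> space circle_measure. real n < norm (boundary_fun f \<zeta>)})"
    have "(\<lambda>n. measure circle_measure (A n)) \<longlonglongrightarrow> measure circle_measure (\<Inter>n. A n)"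
      using sets by (intro circle.finite_Lim_measure_decseq) (auto simp: A_def decseq_def simp del: space_circle_measure)
    moreover have "(\<Inter>n. A n) = {}"
    proof -
      have "\<exists>n. \<zeta> \<notin> A n" for \<zeta>
      proof -
        obtain n where "norm (boundary_fun f \<zeta>) < real n" using reals_Archimedean2 by blast
        then show ?thesis by (intro exI[of _ n]) (simp add: A_def)
      qed
      then show ?thesis by blast
    qed
    ultimately show ?thesis by (simp add: D_eq A_def)
  qed
  have main: "D t \<le> (K0 / t) powr p" if t: "t > 0" for t
  proof (rule ccontr)
    assume "\<not> ?thesis"
    then obtain s where s: "(K0 / t) powr p < s" "s < D t"
      using dense[of "(K0 / t) powr p" "D t"] by auto
    \<comment> \<open>The rearrangement at this \<open>s\<close> is below \<open>t\<close>, so \<open>D\<close> is at most \<open>s\<close> already before \<open>t\<close>.\<close>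
    then have s0: "0 < s" by (meson le_less_trans powr_ge_zero)
    have "K0 / t = ((K0 / t) powr p) powr (1/p)" using K0 t p by (simp add: powr_powr)
    also have "\<dots> < s powr (1/p)" using s p by (intro powr_less_mono2) auto
    finally have "K0 < t * s powr (1/p)" using t by (simp add: field_simps)
    then have "decr_rearr (boundary_fun f) s * s powr (1/p) < t * s powr (1/p)"
      using K[OF s0] K0 by linarith
    then have lt: "Inf {t. t \<ge> 0 \<and> D t \<le> s} < t"
      using s0 by (simp add: decr_rearr_def D_def)
    have ne: "{t. t \<ge> 0 \<and> D t \<le> s} \<noteq> {}"
    proof -
      have "\<forall>\<^sub>F n in sequentially. D (real n) < s"
        using D_lim s0 by (rule order_tendstoD(2))
      then obtain n where "D (real n) < s" by (meson eventually_happens trivial_limit_sequentially)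
      then have "real n \<in> {t. t \<ge> 0 \<and> D t \<le> s}" by simp
      then show ?thesis by blast
    qed
    obtain t' where "D t' \<le> s" "t' < t"
      using cInf_lessD[OF ne lt] by auto
    with D_mono[of t' t] s show False by simp
  qed
  show thesis
  proof
    show "0 \<le> K0 powr p" by simp
    fix t :: real assume t: "t > 0"
    have "(K0 / t) powr p = K0 powr p * t powr - p"
      using K0 t by (simp add: powr_divide powr_minus_divide)
    then show "emeasure circle_measure {\<zeta> \<in> space circle_measure. t < norm (boundary_fun f \<zeta>)} \<le> ennreal (K0 powr p * t powr - p)"
      using main[OF t] by (simp add: circle.emeasure_eq_measure D_eq ennreal_leI)
  qed
qed

lemma log_plus_split:
  assumes "1 \<le> B" "0 \<le> x"
  shows "log_plus x = log_plus (min x B) + log_plus (x / B)"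
proof (cases "x \<le> B")
  case True
  then show ?thesis using assms by (simp add: log_plus_def)
next
  case False
  then have "1 \<le> x" "1 \<le> x / B" using assms by (auto simp: field_simps)
  then show ?thesis using False assms by (simp add: log_plus_def max_def ln_div)
qed

text \<open>The boundary function is cut at the height for which \<open>B powr (-p) = 1 - norm z\<close>. The part of
\<open>log\<^sup>+\<close> above \<open>B\<close> then has Poisson integral at most \<open>2 * C / p\<close>, and Jensen's inequality takes care of the
part below \<open>B\<close>.\<close>

lemma weak_hardy_pointwise:
  assumes f: "f \<in> smirnov" and p: "0 < p" "p < 1" and C: "0 \<le> C"
    and wt: "\<And>t. t > 0 \<Longrightarrow> emeasure circle_measure {\<zeta> \<in> space circle_measure. t < norm (boundary_fun f \<zeta>)} \<le> ennreal (C * t powr - p)"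
    and z: "norm z < 1"
  defines "B \<equiv> (1 - norm z) powr (- 1 / p)"
  shows "ennreal (norm (f z)) \<le> ennreal (exp (2 * C / p)) * (\<integral>\<^sup>+\<zeta>. ennreal (poisson_kernel z \<zeta> * (1 + min (norm (boundary_fun f \<zeta>)) B)) \<partial>circle_measure)"
proof -
  define g where "g = (\<lambda>\<zeta>. norm (boundary_fun f \<zeta>))"
  define u where "u = (\<lambda>\<zeta>. log_plus (min (g \<zeta>) B))"
  define v where "v = (\<lambda>\<zeta>. log_plus (g \<zeta> / B))"
  have B: "1 \<le> B" "B powr - p = 1 - norm z"
  proof -
    show "B powr - p = 1 - norm z" using z p by (simp add: B_def powr_powr)
    have "1 powr (-1/p) \<le> (1 - norm z) powr (-1/p)"
      using z p by (intro powr_mono2') auto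
    then show "1 \<le> B" by (simp add: B_def)
  qed
  note [measurable] = smirnov_boundary(2)[OF f]
  have [measurable]: "g \<in> borel_measurable circle_measure" unfolding g_def by measurable
  have [measurable]: "u \<in> borel_measurable circle_measure" "v \<in> borel_measurable circle_measure"
    unfolding u_def v_def by measurable
  have g0: "0 \<le> g \<zeta>" for \<zeta> by (simp add: g_def)
  have Pm [measurable]: "poisson_kernel z \<in> borel_measurable circle_measure"
    by (intro borel_measurable_circle_continuous continuous_intros z)
  have Pb: "\<bar>poisson_kernel z \<zeta>\<bar> \<le> 2 / (1 - norm z)" if "\<zeta> \<in> sphere 0 1" for \<zeta>
    using that poisson_kernel_le[OF z] poisson_kernel_nonneg[OF z] by simp
  note iP = integrable_bounded_mult_circle[OF Pm _ Pb]
  have tail: "(\<integral>\<^sup>+ \<zeta>. ennreal (v \<zeta>) \<partial>circle_measure) \<le> ennreal (C / p * (1 - norm z))"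
    using weak_type_log_tail[OF circle.sigma_finite_measure_axioms \<open>g \<in> _\<close>, of C p B] wt p C B
    by (simp add: v_def g_def)
  have v: "integrable circle_measure v"
    unfolding integrable_iff_bounded using tail
    by (auto simp: v_def log_plus_nonneg intro: le_less_trans)
  have vle: "(\<integral>\<zeta>. v \<zeta> \<partial>circle_measure) \<le> C / p * (1 - norm z)"
    using tail C p z nn_integral_eq_integral[OF v]
    by (simp add: v_def log_plus_nonneg)
  have u: "integrable circle_measure u"
  proof (rule circle.integrable_const_bound[of _ "log_plus B"])
    show "AE \<zeta> in circle_measure. norm (u \<zeta>) \<le> log_plus B"
      by (rule AE_I2) (auto simp: u_def log_plus_nonneg intro!: log_plus_mono)
  qed measurable
  have h0: "0 \<le> poisson_kernel z \<zeta> * (1 + min (g \<zeta>) B)" for \<zeta>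
    using B g0[of \<zeta>] by (intro mult_nonneg_nonneg poisson_kernel_nonneg z) auto
  have ih: "integrable circle_measure (\<lambda>\<zeta>. poisson_kernel z \<zeta> * (1 + min (g \<zeta>) B))"
  proof (rule iP, rule circle.integrable_const_bound[of _ "1 + B"])
    show "AE \<zeta> in circle_measure. norm (1 + min (g \<zeta>) B) \<le> 1 + B"
    proof (rule AE_I2)
      fix \<zeta>
      have "0 \<le> min (g \<zeta>) B" using B g0[of \<zeta>] by simp
      then show "norm (1 + min (g \<zeta>) B) \<le> 1 + B" by simp
    qed
  qed measurable
  have uv: "log_plus (norm (boundary_fun f \<zeta>)) = u \<zeta> + v \<zeta>" for \<zeta>
    unfolding u_def v_def g_def by (rule log_plus_split) (use B in auto)
  have "log_plus (norm (f z)) \<le> (\<integral>\<zeta>. poisson_kernel z \<zeta> * (u \<zeta> + v \<zeta>) \<partial>circle_measure)"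
    using smirnov_log_plus_le[OF f _ z] u v by (simp add: uv)
  also have "\<dots> = (\<integral>\<zeta>. poisson_kernel z \<zeta> * u \<zeta> \<partial>circle_measure) + (\<integral>\<zeta>. poisson_kernel z \<zeta> * v \<zeta> \<partial>circle_measure)"
    using iP[OF u] iP[OF v] by (simp add: distrib_left)
  also have "(\<integral>\<zeta>. poisson_kernel z \<zeta> * v \<zeta> \<partial>circle_measure) \<le> (\<integral>\<zeta>. 2 / (1 - norm z) * v \<zeta> \<partial>circle_measure)"
  proof (rule integral_mono)
    fix \<zeta> assume "\<zeta> \<in> space circle_measure"
    then show "poisson_kernel z \<zeta> * v \<zeta> \<le> 2 / (1 - norm z) * v \<zeta>"
      using Pb[of \<zeta>] by (intro mult_right_mono) (auto simp: v_def log_plus_nonneg)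
  qed (use iP[OF v] v in auto)
  also have "\<dots> \<le> 2 / (1 - norm z) * (C / p * (1 - norm z))"
    using vle z by (simp only: integral_mult_right_zero) (intro mult_left_mono, auto)
  also have "\<dots> = 2 * C / p" using z by simp
  finally have "log_plus (norm (f z)) \<le> (\<integral>\<zeta>. poisson_kernel z \<zeta> * u \<zeta> \<partial>circle_measure) + 2 * C / p" by simp
  then have "norm (f z) \<le> exp ((\<integral>\<zeta>. poisson_kernel z \<zeta> * u \<zeta> \<partial>circle_measure) + 2 * C / p)"
    using le_exp_log_plus[of "norm (f z)"] by (meson exp_le_cancel_iff order_trans)
  also have "\<dots> = exp (2 * C / p) * exp (\<integral>\<zeta>. poisson_kernel z \<zeta> * u \<zeta> \<partial>circle_measure)"
    by (simp add: exp_add)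
  also have "exp (\<integral>\<zeta>. poisson_kernel z \<zeta> * u \<zeta> \<partial>circle_measure) \<le> (\<integral>\<zeta>. poisson_kernel z \<zeta> * exp (u \<zeta>) \<partial>circle_measure)"
  proof (rule exp_integral_le)
    show "integrable circle_measure (poisson_kernel z)"
      by (intro integrable_circle_continuous continuous_intros z)
    show "integrable circle_measure (\<lambda>\<zeta>. poisson_kernel z \<zeta> * u \<zeta>)" by (rule iP[OF u])
    have "integrable circle_measure (\<lambda>\<zeta>. exp (u \<zeta>))"
    proof (rule circle.integrable_const_bound[of _ "exp (log_plus B)"])
      show "AE \<zeta> in circle_measure. norm (exp (u \<zeta>)) \<le> exp (log_plus B)"
        by (rule AE_I2) (auto simp: u_def intro!: log_plus_mono)
    qed measurable
    then show "integrable circle_measure (\<lambda>\<zeta>. poisson_kernel z \<zeta> * exp (u \<zeta>))" by (rule iP)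
  qed (use z in \<open>simp_all add: integral_poisson_kernel poisson_kernel_nonneg\<close>)
  also have "(\<integral>\<zeta>. poisson_kernel z \<zeta> * exp (u \<zeta>) \<partial>circle_measure) \<le>
      (\<integral>\<zeta>. poisson_kernel z \<zeta> * (1 + min (g \<zeta>) B) \<partial>circle_measure)"
  proof (rule integral_mono')
    show "integrable circle_measure (\<lambda>\<zeta>. poisson_kernel z \<zeta> * (1 + min (g \<zeta>) B))" by (rule ih)
    fix \<zeta>
    have "exp (u \<zeta>) = max 1 (min (g \<zeta>) B)" by (simp add: u_def log_plus_def)
    also have "\<dots> \<le> 1 + min (g \<zeta>) B" using B g0[of \<zeta>] by auto
    finally show "poisson_kernel z \<zeta> * exp (u \<zeta>) \<le> poisson_kernel z \<zeta> * (1 + min (g \<zeta>) B)"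
      by (intro mult_left_mono poisson_kernel_nonneg z)
    show "0 \<le> poisson_kernel z \<zeta> * (1 + min (g \<zeta>) B)"
      by (rule h0)
  qed
  finally have "norm (f z) \<le> exp (2 * C / p) * (\<integral>\<zeta>. poisson_kernel z \<zeta> * (1 + min (g \<zeta>) B) \<partial>circle_measure)"
    by simp
  moreover have "(\<integral>\<^sup>+\<zeta>. ennreal (poisson_kernel z \<zeta> * (1 + min (g \<zeta>) B)) \<partial>circle_measure) =
      ennreal (\<integral>\<zeta>. poisson_kernel z \<zeta> * (1 + min (g \<zeta>) B) \<partial>circle_measure)"
    using h0 by (intro nn_integral_eq_integral ih) auto
  ultimately show ?thesis
    unfolding g_def by (simp add: ennreal_leI flip: ennreal_mult')
qed

text \<open>The Poisson kernel also has mean \<open>1\<close> in the position \<open>\<eta>\<close> of the point, so after exchanging the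
integrals only the integral of the truncated boundary function remains.\<close>

lemma weak_hardy_integral_mean:
  assumes f: "f \<in> smirnov" and p: "0 < p" "p < 1" and C: "0 \<le> C"
    and wt: "\<And>t. t > 0 \<Longrightarrow> emeasure circle_measure {\<zeta> \<in> space circle_measure. t < norm (boundary_fun f \<zeta>)} \<le> ennreal (C * t powr - p)"
    and r: "0 \<le> r" "r < 1"
  shows "(\<integral>\<^sup>+\<eta>. ennreal (norm (f (of_real r * \<eta>))) \<partial>circle_measure) \<le>
    ennreal (exp (2 * C / p) * (1 + C / (1 - p)) * (1 - r) powr (1 - 1 / p))"
proof -
  define B where "B = (1 - r) powr (- 1 / p)"
  define h where "h = (\<lambda>\<zeta>. 1 + min (norm (boundary_fun f \<zeta>)) B)"
  define E where "E = exp (2 * C / p)"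
  interpret pair_sigma_finite circle_measure circle_measure ..
  note [measurable] = smirnov_boundary(2)[OF f]
  have [measurable]: "h \<in> borel_measurable circle_measure" unfolding h_def by measurable
  have B: "1 \<le> B" "B powr (1 - p) = (1 - r) powr (1 - 1 / p)"
  proof -
    have "- 1 / p * (1 - p) = 1 - 1 / p" using p by (simp add: field_simps)
    then show "B powr (1 - p) = (1 - r) powr (1 - 1 / p)" by (simp only: B_def powr_powr)
    have "1 powr (-1/p) \<le> (1 - r) powr (-1/p)"
      using r p by (intro powr_mono2') auto
    then show "1 \<le> B" by (simp add: B_def)
  qed
  have h0: "0 \<le> h \<zeta>" for \<zeta> using B by (simp add: h_def)
  have [measurable]: "fst \<in> borel_measurable (circle_measure \<Otimes>\<^sub>M circle_measure)"
    "snd \<in> borel_measurable (circle_measure \<Otimes>\<^sub>M circle_measure)"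
    "(\<lambda>q. h (snd q)) \<in> borel_measurable (circle_measure \<Otimes>\<^sub>M circle_measure)"
    using measurable_compose[OF measurable_fst id_measurable_circle]
      measurable_compose[OF measurable_snd id_measurable_circle]
      measurable_compose[OF measurable_snd \<open>h \<in> _\<close>] by auto
  have Q: "(\<lambda>q. ennreal (poisson_kernel (of_real r * fst q) (snd q) * h (snd q))) \<in>
      borel_measurable (circle_measure \<Otimes>\<^sub>M circle_measure)"
    unfolding poisson_kernel_def
    by (intro measurable_compose[OF _ measurable_ennreal] borel_measurable_times borel_measurable_divide
        borel_measurable_diff borel_measurable_power borel_measurable_const
        measurable_compose[OF _ borel_measurable_norm]) auto
  have "(\<integral>\<^sup>+\<eta>. ennreal (norm (f (of_real r * \<eta>))) \<partial>circle_measure) \<le>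
      (\<integral>\<^sup>+\<eta>. ennreal E * (\<integral>\<^sup>+\<zeta>. ennreal (poisson_kernel (of_real r * \<eta>) \<zeta> * h \<zeta>) \<partial>circle_measure) \<partial>circle_measure)"
  proof (rule nn_integral_mono)
    fix \<eta> assume "\<eta> \<in> space circle_measure"
    then have n: "norm (of_real r * \<eta>) = r" using r by (simp add: norm_mult)
    then show "ennreal (norm (f (of_real r * \<eta>))) \<le>
        ennreal E * (\<integral>\<^sup>+\<zeta>. ennreal (poisson_kernel (of_real r * \<eta>) \<zeta> * h \<zeta>) \<partial>circle_measure)"
      using weak_hardy_pointwise[OF f p C wt, of "of_real r * \<eta>"] r
      unfolding n B_def[symmetric] E_def[symmetric] h_def by simp
  qed
  also have "\<dots> = ennreal E * (\<integral>\<^sup>+\<eta>. (\<integral>\<^sup>+\<zeta>. ennreal (poisson_kernel (of_real r * \<eta>) \<zeta> * h \<zeta>) \<partial>circle_measure) \<partial>circle_measure)"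
    by (intro nn_integral_cmult circle.borel_measurable_nn_integral) (use Q in \<open>simp add: case_prod_beta\<close>)
  also have "(\<integral>\<^sup>+\<eta>. (\<integral>\<^sup>+\<zeta>. ennreal (poisson_kernel (of_real r * \<eta>) \<zeta> * h \<zeta>) \<partial>circle_measure) \<partial>circle_measure) =
      (\<integral>\<^sup>+\<zeta>. (\<integral>\<^sup>+\<eta>. ennreal (poisson_kernel (of_real r * \<eta>) \<zeta> * h \<zeta>) \<partial>circle_measure) \<partial>circle_measure)"
    by (rule Fubini'[symmetric]) (use Q in \<open>simp add: case_prod_beta\<close>)
  also have "\<dots> = (\<integral>\<^sup>+\<zeta>. ennreal (h \<zeta>) \<partial>circle_measure)"
  proof (rule nn_integral_cong)
    fix \<zeta> assume z: "\<zeta> \<in> space circle_measure"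
    then have n: "norm (of_real r * \<zeta>) < 1" using r by (simp add: norm_mult)
    have "(\<integral>\<^sup>+\<eta>. ennreal (poisson_kernel (of_real r * \<eta>) \<zeta> * h \<zeta>) \<partial>circle_measure) =
        (\<integral>\<^sup>+\<eta>. ennreal (poisson_kernel (of_real r * \<zeta>) \<eta>) * ennreal (h \<zeta>) \<partial>circle_measure)"
    proof (rule nn_integral_cong)
      fix \<eta> assume "\<eta> \<in> space circle_measure"
      then have "poisson_kernel (of_real r * \<eta>) \<zeta> = poisson_kernel (of_real r * \<zeta>) \<eta>"
        using z by (intro poisson_kernel_swap) auto
      then show "ennreal (poisson_kernel (of_real r * \<eta>) \<zeta> * h \<zeta>) = ennreal (poisson_kernel (of_real r * \<zeta>) \<eta>) * ennreal (h \<zeta>)"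
        by (simp add: ennreal_mult poisson_kernel_nonneg[OF n] h0)
    qed
    also have "\<dots> = (\<integral>\<^sup>+\<eta>. ennreal (poisson_kernel (of_real r * \<zeta>) \<eta>) \<partial>circle_measure) * ennreal (h \<zeta>)"
    proof (rule nn_integral_multc)
      have [measurable]: "poisson_kernel (of_real r * \<zeta>) \<in> borel_measurable circle_measure"
        by (rule borel_measurable_circle_continuous(2)[OF continuous_on_poisson_kernel[OF n]])
      show "(\<lambda>\<eta>. ennreal (poisson_kernel (of_real r * \<zeta>) \<eta>)) \<in> borel_measurable circle_measure"
        by measurable
    qed
    also have "(\<integral>\<^sup>+\<eta>. ennreal (poisson_kernel (of_real r * \<zeta>) \<eta>) \<partial>circle_measure) = ennreal (\<integral>\<eta>. poisson_kernel (of_real r * \<zeta>) \<eta> \<partial>circle_measure)"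
      by (intro nn_integral_eq_integral integrable_circle_continuous continuous_intros n AE_I2 poisson_kernel_nonneg)
    finally show "(\<integral>\<^sup>+\<eta>. ennreal (poisson_kernel (of_real r * \<eta>) \<zeta> * h \<zeta>) \<partial>circle_measure) = ennreal (h \<zeta>)"
      by (simp add: integral_poisson_kernel[OF n])
  qed
  also have "\<dots> = (\<integral>\<^sup>+\<zeta>. 1 + ennreal (min (norm (boundary_fun f \<zeta>)) B) \<partial>circle_measure)"
    using B by (intro nn_integral_cong) (simp add: h_def ennreal_plus)
  also have "\<dots> = 1 + (\<integral>\<^sup>+\<zeta>. ennreal (min (norm (boundary_fun f \<zeta>)) B) \<partial>circle_measure)"
    by (subst nn_integral_add) (auto simp: emeasure_circle_measure)
  also have "\<dots> \<le> 1 + ennreal (C / (1 - p) * B powr (1 - p))"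
    using B p C
    by (intro add_left_mono weak_type_truncation[OF circle.sigma_finite_measure_axioms] wt) auto
  also have "\<dots> \<le> ennreal ((1 + C / (1 - p)) * B powr (1 - p))"
  proof -
    have "1 \<le> B powr (1 - p)" using B p by (intro ge_one_powr_ge_zero) auto
    then have "ennreal (1 + C / (1 - p) * B powr (1 - p)) \<le> ennreal ((1 + C / (1 - p)) * B powr (1 - p))"
      by (intro ennreal_leI) (simp add: distrib_right)
    then show ?thesis using C p by (simp add: ennreal_plus)
  qed
  finally have "(\<integral>\<^sup>+\<eta>. ennreal (norm (f (of_real r * \<eta>))) \<partial>circle_measure) \<le>
      ennreal E * ennreal ((1 + C / (1 - p)) * B powr (1 - p))"
    by (simp add: mult_left_mono)
  then show ?thesis
    using C p by (simp add: E_def B mult.assoc flip: ennreal_mult)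
qed

lemma taylor_coeff_le_integral_mean:
  assumes f: "f holomorphic_on ball 0 1" and a: "\<And>z. z \<in> ball 0 1 \<Longrightarrow> (\<lambda>n. a n * z ^ n) sums f z"
    and r: "0 \<le> r" "r < 1"
  shows "ennreal (norm (a n) * r ^ n) \<le> (\<integral>\<^sup>+\<eta>. ennreal (norm (f (of_real r * \<eta>))) \<partial>circle_measure)"
proof -
  define G where "G = (\<lambda>z. f (of_real r * z))"
  note G = continuous_on_dilation[OF f r, folded G_def]
  define h where "h = (\<lambda>\<zeta>. G \<zeta> / \<zeta> ^ n)"
  have h: "continuous_on (sphere 0 1) h"
    unfolding h_def by (intro continuous_intros G) auto
  have "G has_fps_expansion Abs_fps (\<lambda>n. a n * of_real r ^ n)"
  proof (rule has_fps_expansionI)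
    have "\<forall>\<^sub>F u in nhds 0. u \<in> ball 0 (1::real)"
      by (rule eventually_nhds_in_open) auto
    then show "\<forall>\<^sub>F u in nhds 0. (\<lambda>n. fps_nth (Abs_fps (\<lambda>n. a n * of_real r ^ n)) n * u ^ n) sums G u"
    proof eventually_elim
      case (elim u)
      have "r * norm u < 1" using elim r mult_mono[of r 1 "norm u" "norm u"] by auto
      then have "of_real r * u \<in> ball 0 1" using r by (simp add: norm_mult)
      from a[OF this] show ?case by (simp add: G_def power_mult_distrib mult.assoc)
    qed
  qed
  then have coeff: "a n * of_real r ^ n = (deriv ^^ n) G 0 / fact n"
    using fps_nth_fps_expansion by fastforce
  have "(2 * pi * \<i>) / (fact n) * (deriv ^^ n) G 0 = 2 * of_real pi * \<i> * (\<integral>\<zeta>. h \<zeta> \<partial>circle_measure)"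
  proof (rule circle_contour_integral[OF h])
    show "((\<lambda>u. G u / (u-0) ^ (Suc n)) has_contour_integral ((2 * pi * \<i>) / (fact n) * (deriv ^^ n) G 0)) (circlepath 0 1)"
      by (rule Cauchy_has_contour_integral_higher_derivative_circlepath[OF G(1,2)]) simp
  qed (auto simp: h_def field_simps)
  then have coeff': "a n * of_real r ^ n = (\<integral>\<zeta>. h \<zeta> \<partial>circle_measure)"
    unfolding coeff by (simp add: field_simps)
  have "norm (a n) * r ^ n = norm (a n * of_real r ^ n)"
    using r by (simp add: norm_mult norm_power)
  also have "\<dots> = norm (\<integral>\<zeta>. h \<zeta> \<partial>circle_measure)"
    by (simp only: coeff')
  also have "ennreal \<dots> \<le> (\<integral>\<^sup>+\<zeta>. ennreal (norm (h \<zeta>)) \<partial>circle_measure)"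
    by (rule integral_norm_bound_ennreal[OF integrable_circle_continuous[OF h]])
  also have "\<dots> = (\<integral>\<^sup>+\<eta>. ennreal (norm (f (of_real r * \<eta>))) \<partial>circle_measure)"
    by (intro nn_integral_cong) (simp add: h_def G_def norm_divide norm_power)
  finally show ?thesis .
qed

text \<open>Compare the Taylor coefficient with the mean of \<open>|f|\<close> on the circle of radius \<open>r = n / (n + 1)\<close>, for
which \<open>r ^ n\<close> stays above \<open>exp (-1)\<close>.\<close>

lemma weak_hardy_coeff_bound:
  assumes a: "a \<in> taylor_seqs (weak_hardy p)" and p: "0 < p" "p < 1"
  obtains K where "0 \<le> K" "\<And>n. norm (a n) \<le> K * pow_weight (1 / p - 1) n"
proof -
  obtain f where f: "f \<in> weak_hardy p" and af: "\<And>z. z \<in> ball 0 1 \<Longrightarrow> (\<lambda>n. a n * z ^ n) sums f z"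
    using a unfolding taylor_seqs_def by blast
  have fs: "f \<in> smirnov" using f by (simp add: weak_hardy_def)
  then have h: "f holomorphic_on ball 0 1" by (simp add: smirnov_def nevanlinna_def H_disk_def)
  obtain C where C: "0 \<le> C"
    and wt: "\<And>t. t > 0 \<Longrightarrow> emeasure circle_measure {\<zeta> \<in> space circle_measure. t < norm (boundary_fun f \<zeta>)} \<le> ennreal (C * t powr - p)"
    using weak_hardy_distribution[OF f p(1)] by blast
  define \<beta> where "\<beta> = 1 / p - 1"
  have \<beta>: "0 < \<beta>" using p by (simp add: \<beta>_def field_simps)
  define D where "D = exp (2 * C / p) * (1 + C / (1 - p))"
  have D: "0 \<le> D" using C p by (simp add: D_def)
  have mean: "norm (a n) * r ^ n \<le> D * (1 - r) powr (- \<beta>)" if r: "0 \<le> r" "r < 1" for r n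
  proof -
    have "ennreal (norm (a n) * r ^ n) \<le> ennreal (D * (1 - r) powr (- \<beta>))"
      using taylor_coeff_le_integral_mean[OF h af r, of n] weak_hardy_integral_mean[OF fs p C wt r]
      unfolding D_def \<beta>_def by (simp add: mult.assoc order_trans)
    then show ?thesis using D by (simp add: ennreal_le_iff)
  qed
  have pos: "norm (a n) \<le> D * exp 1 * 2 powr \<beta> * real n powr \<beta>" if n: "n \<ge> 1" for n
  proof -
    define r where "r = real n / (real n + 1)"
    have r: "0 < r" "r < 1" "1 - r = inverse (real n + 1)" using n by (auto simp: r_def field_simps)
    have "inverse r = 1 + 1 / real n" using n by (simp add: r_def field_simps)
    also have "\<dots> \<le> exp (1 / real n)" by (rule exp_ge_add_one_self)
    finally have "inverse r ^ n \<le> exp (1 / real n) ^ n" using r by (intro power_mono) auto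
    also have "\<dots> = exp 1" using n by (simp flip: exp_of_nat_mult)
    finally have e: "inverse r ^ n \<le> exp 1" .
    have "(1 - r) powr (- \<beta>) = (real n + 1) powr \<beta>"
      unfolding r(3) by (simp add: powr_minus inverse_powr)
    also have "\<dots> \<le> (2 * real n) powr \<beta>" using n \<beta> by (intro powr_mono2) auto
    also have "\<dots> = 2 powr \<beta> * real n powr \<beta>" by (simp add: powr_mult)
    finally have b: "(1 - r) powr (- \<beta>) \<le> 2 powr \<beta> * real n powr \<beta>" .
    have "norm (a n) = norm (a n) * r ^ n * inverse r ^ n"
      using r by (simp add: power_inverse)
    also have "\<dots> \<le> (D * (2 powr \<beta> * real n powr \<beta>)) * exp 1"
    proof (rule mult_mono[OF _ e])
      show "norm (a n) * r ^ n \<le> D * (2 powr \<beta> * real n powr \<beta>)"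
        using mean[of r n] mult_left_mono[OF b D] r by linarith
    qed (use D r in auto)
    finally show ?thesis by (simp add: mult_ac)
  qed
  show thesis
  proof
    show "0 \<le> max (norm (a 0)) (D * exp 1 * 2 powr \<beta>)" by (simp add: le_max_iff_disj)
    fix n
    show "norm (a n) \<le> max (norm (a 0)) (D * exp 1 * 2 powr \<beta>) * pow_weight (1 / p - 1) n"
    proof (cases "n = 0")
      case False
      then have "norm (a n) \<le> D * exp 1 * 2 powr \<beta> * real n powr \<beta>" by (intro pos) simp
      also have "\<dots> \<le> max (norm (a 0)) (D * exp 1 * 2 powr \<beta>) * real n powr \<beta>"
        by (intro mult_right_mono) auto
      finally show ?thesis using False by (simp add: pow_weight_def \<beta>_def)
    qed (simp add: pow_weight_def)
  qed
qed

section \<open>An extremal function\<close>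

text \<open>Jordan's inequality: the sine is concave on \<open>[0, pi]\<close>, hence lies above its chord from \<open>0\<close> to \<open>pi / 2\<close>.\<close>

lemma jordan_sin:
  assumes "0 \<le> x" "x \<le> pi / 2"
  shows "2 * x / pi \<le> sin x"
proof -
  have "convex_on {0..pi} (\<lambda>x. - sin x)"
    by (rule f''_ge0_imp_convex[where f'="\<lambda>x. - cos x" and f''=sin])
       (auto intro!: derivative_eq_intros sin_ge_zero)
  moreover define u where "u = 2 * x / pi"
  moreover have "0 \<le> u" "u \<le> 1" using assms by (auto simp: u_def field_simps)
  ultimately have "- sin ((1 - u) *\<^sub>R 0 + u *\<^sub>R (pi/2)) \<le> (1 - u) * - sin 0 + u * - sin (pi/2)"
    by (intro convex_onD) auto
  then show ?thesis by (simp add: u_def)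
qed

lemma norm_one_minus_cis: "norm (1 - cis t) = 2 * \<bar>sin (t / 2)\<bar>"
proof -
  have "(norm (1 - cis t))\<^sup>2 = 2 - 2 * cos t"
    using sin_cos_squared_add[of t] unfolding cmod_power2 by (simp add: power2_eq_square algebra_simps)
  also have "cos t = 1 - 2 * (sin (t/2))\<^sup>2"
    using cos_double_sin[of "t/2"] by simp
  finally have "(norm (1 - cis t))\<^sup>2 = (2 * \<bar>sin (t / 2)\<bar>)\<^sup>2" by (simp add: power_mult_distrib)
  then show ?thesis by (rule power2_eq_imp_eq) auto
qed

lemma circle_ball_sets:
  "{\<zeta> \<in> space circle_measure. norm (1 - \<zeta>) < s} \<in> sets circle_measure"
  by (intro borel_measurable_less borel_measurable_circle_continuous continuous_intros)

text \<open>By Jordan's inequality \<open>norm (1 - cis t)\<close> is at least \<open>2 / pi\<close> times the arc from \<open>1\<close> to \<open>cis t\<close>, so the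
parameters \<open>t\<close> lie in two intervals of length \<open>pi * s / 2\<close> at the ends of \<open>[0, 2 * pi]\<close>.\<close>

lemma emeasure_circle_ball:
  assumes s: "0 < s"
  shows "emeasure circle_measure {\<zeta> \<in> space circle_measure. norm (1 - \<zeta>) < s} \<le> ennreal s"
proof -
  let ?A = "{\<zeta> \<in> space borel_circle. norm (1 - \<zeta>) < s}"
  have sp: "space borel_circle = space circle_measure"
    by (simp add: circle_measure_completion)
  have A: "?A \<in> sets borel_circle"
    by (intro borel_measurable_less borel_measurable_circle_continuous continuous_intros)
  have "emeasure circle_measure ?A = (\<integral>\<^sup>+\<zeta>. indicator ?A \<zeta> \<partial>circle_measure)"
    using circle_ball_sets[of s] by (simp add: sp)
  also have "\<dots> = (\<integral>\<^sup>+t. indicator ?A (cis t) * indicator {0..2*pi} t \<partial>lborel) / ennreal (2 * pi)"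
    by (rule nn_integral_circle) (use A in simp)
  also have "\<dots> \<le> (\<integral>\<^sup>+t. indicator ({0..pi * s / 2} \<union> {2*pi - pi * s / 2 .. 2*pi}) t \<partial>lborel) / ennreal (2 * pi)"
  proof (intro divide_right_mono_ennreal nn_integral_mono)
    fix t :: real
    have "t \<in> {0..pi * s / 2} \<union> {2*pi - pi * s / 2 .. 2*pi}" if t: "t \<in> {0..2*pi}" and n: "norm (1 - cis t) < s"
    proof -
      have "0 \<le> sin (t / 2)" using t by (intro sin_ge_zero) auto
      then have sin: "2 * sin (t / 2) < s" using n by (simp add: norm_one_minus_cis)
      show ?thesis
      proof (cases "t \<le> pi")
        case True
        then have "2 * (t/2) / pi \<le> sin (t/2)" using t by (intro jordan_sin) auto
        then have "2 * (2 * (t/2) / pi) < s" using sin by linarith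
        then show ?thesis using t by (simp add: field_simps)
      next
        case False
        \<comment> \<open>The circle is symmetric about the real axis: apply the inequality to \<open>pi - t / 2\<close>.\<close>
        then have "2 * (pi - t/2) / pi \<le> sin (pi - t/2)" using t by (intro jordan_sin) auto
        then have "2 * (pi - t/2) / pi \<le> sin (t/2)" by simp
        then have "2 * (2 * (pi - t/2) / pi) < s" using sin by linarith
        then show ?thesis using t by (simp add: field_simps)
      qed
    qed
    then show "indicator ?A (cis t) * indicator {0..2*pi} t \<le>
        (indicator ({0..pi * s / 2} \<union> {2*pi - pi * s / 2 .. 2*pi}) t :: ennreal)"
      by (auto simp: indicator_def)
  qed
  also have "(\<integral>\<^sup>+t. indicator ({0..pi * s / 2} \<union> {2*pi - pi * s / 2 .. 2*pi}) t \<partial>lborel) \<le> ennreal (pi * s)"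
  proof -
    have "(\<integral>\<^sup>+t. indicator ({0..pi * s / 2} \<union> {2*pi - pi * s / 2 .. 2*pi}) t \<partial>lborel) =
        emeasure lborel ({0..pi * s / 2} \<union> {2*pi - pi * s / 2 .. 2*pi})" by simp
    also have "\<dots> \<le> emeasure lborel {0..pi * s / 2} + emeasure lborel {2*pi - pi * s / 2 .. 2*pi}"
      by (rule emeasure_subadditive) auto
    also have "\<dots> = ennreal (pi * s)" using s by (simp flip: ennreal_plus)
    finally show ?thesis .
  qed
  also have "ennreal (pi * s) / ennreal (2 * pi) = ennreal (s / 2)"
    using s by (simp add: divide_ennreal)
  also have "\<dots> \<le> ennreal s" using s by (intro ennreal_leI) auto
  finally show ?thesis by (simp add: sp divide_right_mono_ennreal)
qed

lemma AE_circle_neq_1: "AE \<zeta> in circle_measure. \<zeta> \<noteq> 1"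
proof (rule AE_I)
  show "{\<zeta> \<in> space circle_measure. \<not> \<zeta> \<noteq> 1} \<subseteq> {1}" by auto
  have *: "{1} = {\<zeta> \<in> space circle_measure. norm (1 - \<zeta>) \<le> 0}" by auto
  show "{1} \<in> sets circle_measure"
    unfolding * by (intro borel_measurable_le borel_measurable_circle_continuous continuous_intros)
  have "emeasure circle_measure {1} \<le> ennreal s" if "0 < s" for s
  proof -
    have "emeasure circle_measure {1} \<le> emeasure circle_measure {\<zeta> \<in> space circle_measure. norm (1 - \<zeta>) < s}"
      using that circle_ball_sets[of s] by (intro emeasure_mono) auto
    then show ?thesis using emeasure_circle_ball[OF that] by (rule order_trans)
  qed
  then show "emeasure circle_measure {1} = 0"
    by (metis ennreal_0 ennreal_le_epsilon ennreal_zero_less_top add_0 le_zero_eq)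
qed

definition cauchy_power :: "real \<Rightarrow> complex \<Rightarrow> complex" where
  "cauchy_power \<alpha> z = (1 - z) powr (- of_real \<alpha>)"

lemma norm_cauchy_power: "norm (cauchy_power \<alpha> z) = norm (1 - z) powr (- \<alpha>)"
  unfolding cauchy_power_def by (subst norm_powr_real_powr') auto

lemma one_minus_nonpos_Reals:
  fixes z :: complex
  assumes "norm z \<le> 1" "z \<noteq> 1"
  shows "1 - z \<notin> \<real>\<^sub>\<le>\<^sub>0"
proof
  assume "1 - z \<in> \<real>\<^sub>\<le>\<^sub>0"
  then have "Im z = 0" "1 \<le> Re z" by (auto simp: complex_nonpos_Reals_iff)
  moreover have "\<bar>Re z\<bar> \<le> 1" using abs_Re_le_cmod[of z] assms by linarith
  ultimately show False using assms by (auto simp: complex_eq_iff)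
qed

lemma cauchy_power_nt_limit:
  assumes "norm \<zeta> = 1" "\<zeta> \<noteq> 1"
  shows "has_nt_limit (cauchy_power \<alpha>) \<zeta> (cauchy_power \<alpha> \<zeta>)"
proof -
  have "isCont (cauchy_power \<alpha>) \<zeta>"
    unfolding cauchy_power_def using one_minus_nonpos_Reals[of \<zeta>] assms
    by (intro continuous_intros isCont_powr_complex) auto
  then have "(cauchy_power \<alpha> \<longlongrightarrow> cauchy_power \<alpha> \<zeta>) (at \<zeta>)" by (simp add: isCont_def)
  then show ?thesis unfolding has_nt_limit_def by (blast intro: tendsto_within_subset)
qed

lemma cauchy_power_holomorphic: "cauchy_power \<alpha> holomorphic_on ball 0 1"
proof -
  have "1 - z \<notin> \<real>\<^sub>\<le>\<^sub>0" if "z \<in> ball 0 1" for z :: complex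
    using that by (intro one_minus_nonpos_Reals) auto
  then show ?thesis
    unfolding cauchy_power_def by (intro holomorphic_intros) auto
qed

lemma cauchy_power_weak_type:
  assumes "0 < \<alpha>" "0 < t"
  shows "{\<zeta> \<in> space circle_measure. t < norm (1 - \<zeta>) powr (- \<alpha>)} \<subseteq>
      {\<zeta> \<in> space circle_measure. norm (1 - \<zeta>) < t powr - (1 / \<alpha>)}"
proof safe
  fix \<zeta> assume *: "t < norm (1 - \<zeta>) powr (- \<alpha>)"
  then have n: "0 < norm (1 - \<zeta>)" using assms by (cases "\<zeta> = 1") auto
  have "norm (1 - \<zeta>) = (norm (1 - \<zeta>) powr (- \<alpha>)) powr - (1 / \<alpha>)"
    using assms n by (simp add: powr_powr)
  also have "\<dots> < t powr - (1 / \<alpha>)" using * assms by (intro powr_less_mono2_neg) auto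
  finally show "norm (1 - \<zeta>) < t powr - (1 / \<alpha>)" .
qed

text \<open>Since \<open>norm (1 - \<zeta>) \<le> 2 * norm (1 - r * \<zeta>)\<close>, all dilations are dominated on the circle by one
weak-type function.\<close>

lemma cauchy_power_dilation_le:
  assumes "0 < \<alpha>" "0 \<le> r" "r \<le> 1" "norm \<zeta> = 1" "\<zeta> \<noteq> 1"
  shows "norm (cauchy_power \<alpha> (of_real r * \<zeta>)) \<le> norm (1 - \<zeta>) powr (- \<alpha>) / (1/2) powr \<alpha>"
proof -
  have "norm (1 - \<zeta>) \<le> norm (1 - of_real r * \<zeta>) + norm (of_real (r - 1) * \<zeta>)"
    using norm_triangle_ineq[of "1 - of_real r * \<zeta>" "of_real (r - 1) * \<zeta>"] by (simp add: algebra_simps)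
  also have "norm (of_real (r - 1) * \<zeta>) = 1 - r" using assms by (simp only: norm_mult norm_of_real) simp
  also have "1 - r \<le> norm (1 - of_real r * \<zeta>)"
    using norm_triangle_ineq2[of 1 "of_real r * \<zeta>"] assms by (simp add: norm_mult)
  finally have "norm (1 - \<zeta>) / 2 \<le> norm (1 - of_real r * \<zeta>)" by simp
  then have "norm (1 - of_real r * \<zeta>) powr (- \<alpha>) \<le> (norm (1 - \<zeta>) / 2) powr (- \<alpha>)"
    using assms by (intro powr_mono2') auto
  also have "\<dots> = norm (1 - \<zeta>) powr (- \<alpha>) / (1/2) powr \<alpha>"
    by (simp add: powr_divide powr_minus field_simps)
  finally show ?thesis by (simp add: norm_cauchy_power)
qed

text \<open>The dilations are dominated uniformly, and \<open>log\<^sup>+\<close> of the dominating weak-type function is integrable.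
This bounds the integrals in the Nevanlinna condition and, by dominated convergence, gives the limit
required in the Smirnov class.\<close>

lemma cauchy_power_in_weak_hardy:
  assumes p: "0 < p"
  shows "cauchy_power (1 / p) \<in> weak_hardy p"
proof -
  define f where "f = cauchy_power (1 / p)"
  define g where "g = (\<lambda>\<zeta>::complex. norm (1 - \<zeta>) powr (- (1 / p)))"
  \<comment> \<open>The dilations are dominated by \<open>g / B\<close>.\<close>
  define B where "B = (1/2::real) powr (1 / p)"
  have B: "0 < B" by (simp add: B_def)
  have g_meas [measurable]: "g \<in> borel_measurable circle_measure"
    unfolding g_def by measurable
  have sub: "{\<zeta> \<in> space circle_measure. t < g \<zeta>} \<subseteq> {\<zeta> \<in> space circle_measure. norm (1 - \<zeta>) < t powr - p}"
    if "0 < t" for t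
    using cauchy_power_weak_type[of "1/p" t] p that by (simp add: g_def)
  have wt: "emeasure circle_measure {\<zeta> \<in> space circle_measure. t < g \<zeta>} \<le> ennreal (1 * t powr - p)" if "0 < t" for t
    using emeasure_mono[OF sub[OF that] circle_ball_sets] emeasure_circle_ball[of "t powr - p"] that
    by (simp add: order_trans)
  have dom_fin: "(\<integral>\<^sup>+\<zeta>. ennreal (log_plus (g \<zeta> / B)) \<partial>circle_measure) < \<infinity>"
    using weak_type_log_tail[OF circle.sigma_finite_measure_axioms g_meas wt p _ B]
    by (rule le_less_trans) auto
  have AE_sphere: "AE \<zeta> in circle_measure. norm \<zeta> = 1 \<and> \<zeta> \<noteq> 1"
    using AE_circle_neq_1 AE_space[of circle_measure] by eventually_elim auto
  have dom: "AE \<zeta> in circle_measure. ennreal (log_plus (norm (f (of_real r * \<zeta>)))) \<le> ennreal (log_plus (g \<zeta> / B))"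
    if "0 \<le> r" "r \<le> 1" for r
    using AE_sphere
    by eventually_elim (use cauchy_power_dilation_le[of "1/p" r] p that in
        \<open>auto simp: f_def g_def B_def intro!: ennreal_leI log_plus_mono\<close>)
  have hol: "f holomorphic_on ball 0 1" unfolding f_def by (rule cauchy_power_holomorphic)
  have bf: "boundary_fun f \<zeta> = f \<zeta>" if "norm \<zeta> = 1" "\<zeta> \<noteq> 1" for \<zeta>
    unfolding f_def by (rule boundary_fun_eqI[OF cauchy_power_nt_limit]) (use that in auto)
  have nev: "f \<in> nevanlinna"
  proof -
    have "(SUP r\<in>{0<..<1::real}. \<integral>\<^sup>+ \<zeta>. ennreal (log_plus (norm (f (of_real r * \<zeta>)))) \<partial>circle_measure)
        \<le> (\<integral>\<^sup>+\<zeta>. ennreal (log_plus (g \<zeta> / B)) \<partial>circle_measure)"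
      by (intro SUP_least nn_integral_mono_AE dom) auto
    then show ?thesis
      using dom_fin hol by (simp add: nevanlinna_def H_disk_def le_less_trans)
  qed
  have smi: "f \<in> smirnov"
  proof -
    have nt: "AE \<zeta> in circle_measure. \<exists>L. has_nt_limit f \<zeta> L"
      using AE_sphere by eventually_elim (auto simp: f_def intro: cauchy_power_nt_limit)
    have eq: "(\<integral>\<^sup>+ \<zeta>. ennreal (log_plus (norm (boundary_fun f \<zeta>))) \<partial>circle_measure) =
        (\<integral>\<^sup>+ \<zeta>. ennreal (log_plus (g \<zeta>)) \<partial>circle_measure)"
      using AE_sphere by (intro nn_integral_cong_AE, eventually_elim)
        (simp add: bf, simp add: f_def g_def norm_cauchy_power)
    have "((\<lambda>r::real. \<integral>\<^sup>+ \<zeta>. ennreal (log_plus (norm (f (of_real r * \<zeta>)))) \<partial>circle_measure)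
        \<longlongrightarrow> (\<integral>\<^sup>+ \<zeta>. ennreal (log_plus (g \<zeta>)) \<partial>circle_measure)) (at_left 1)"
    proof (rule tendsto_at_left_sequentially[of 0])
      fix S :: "nat \<Rightarrow> real" assume S: "\<And>n. S n < 1" "\<And>n. 0 < S n" "S \<longlonglongrightarrow> 1"
      show "(\<lambda>n. \<integral>\<^sup>+ \<zeta>. ennreal (log_plus (norm (f (of_real (S n) * \<zeta>)))) \<partial>circle_measure) \<longlonglongrightarrow>
          (\<integral>\<^sup>+ \<zeta>. ennreal (log_plus (g \<zeta>)) \<partial>circle_measure)"
      proof (rule nn_integral_dominated_convergence[where w="\<lambda>\<zeta>. ennreal (log_plus (g \<zeta> / B))"])
        have [measurable]: "(\<lambda>\<zeta>. f (of_real (S n) * \<zeta>)) \<in> borel_measurable circle_measure" for n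
          using S by (intro borel_measurable_circle_continuous(2) continuous_on_dilation(3)[OF hol] less_imp_le)
        show "(\<lambda>\<zeta>. ennreal (log_plus (norm (f (of_real (S n) * \<zeta>))))) \<in> borel_measurable circle_measure" for n
          by measurable
        show "AE \<zeta> in circle_measure. (\<lambda>n. ennreal (log_plus (norm (f (of_real (S n) * \<zeta>))))) \<longlonglongrightarrow> ennreal (log_plus (g \<zeta>))"
          using AE_sphere
        proof eventually_elim
          case (elim \<zeta>)
          have fl: "filterlim S (at_left 1) sequentially"
            using S by (auto simp: filterlim_at less_imp_neq)
          have "((\<lambda>r. f (of_real r * \<zeta>)) \<longlongrightarrow> f \<zeta>) (at_left (1::real))"
            unfolding f_def using elim by (intro has_nt_limit_radial cauchy_power_nt_limit) auto
          from filterlim_compose[OF this fl] have "(\<lambda>n. norm (f (of_real (S n) * \<zeta>))) \<longlonglongrightarrow> norm (f \<zeta>)"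
            by (rule tendsto_norm)
          then show ?case
            by (intro tendsto_ennrealI isCont_tendsto_compose[OF isCont_log_plus])
               (auto simp: f_def g_def norm_cauchy_power)
        qed
      qed (use S dom dom_fin in \<open>auto simp: less_imp_le\<close>)
    qed simp
    then show ?thesis using nev nt by (simp add: smirnov_def eq)
  qed
  have "decr_rearr (boundary_fun f) s * s powr (1 / p) \<le> 1" if s: "0 < s" for s
  proof -
    \<comment> \<open>The level at which the bound \<open>t powr - p\<close> on the distribution function equals \<open>s\<close>.\<close>
    define t where "t = s powr (- (1 / p))"
    have t: "0 < t" "t powr - p = s" using s p by (simp_all add: t_def powr_powr)
    have "{\<zeta> \<in> sphere 0 1. t < norm (boundary_fun f \<zeta>)} \<subseteq> {\<zeta> \<in> space circle_measure. norm (1 - \<zeta>) < s}"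
    \<comment> \<open>There is no nontangential limit at \<open>1\<close>, but this point lies in the set on the right anyway.\<close>
    proof safe
      fix \<zeta> assume \<zeta>: "\<zeta> \<in> sphere 0 1" "t < norm (boundary_fun f \<zeta>)"
      show "norm (1 - \<zeta>) < s"
      proof (cases "\<zeta> = 1")
        case False
        then have "t < g \<zeta>" using \<zeta> by (simp add: bf, simp add: f_def g_def norm_cauchy_power)
        then show ?thesis using sub[OF t(1)] \<zeta> t by auto
      qed (use s in simp)
    qed simp
    then have "distribution_fun (boundary_fun f) t \<le> measure circle_measure {\<zeta> \<in> space circle_measure. norm (1 - \<zeta>) < s}"
      unfolding distribution_fun_def by (rule circle.finite_measure_mono[OF _ circle_ball_sets])
    also have "\<dots> \<le> s"
      using emeasure_circle_ball[OF s] s by (simp add: circle.emeasure_eq_measure)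
    finally have "decr_rearr (boundary_fun f) s \<le> t"
      unfolding decr_rearr_def using t by (intro cInf_lower bdd_belowI[of _ 0]) auto
    then have "decr_rearr (boundary_fun f) s * s powr (1 / p) \<le> t * s powr (1 / p)"
      by (rule mult_right_mono) simp
    also have "\<dots> = 1" using s by (simp add: t_def flip: powr_add)
    finally show ?thesis .
  qed
  then show ?thesis
    using smi unfolding weak_hardy_def f_def by (auto intro!: bdd_aboveI[of _ 1])
qed

lemma cauchy_power_taylor:
  assumes "norm z < 1"
  shows "(\<lambda>n. of_real (pochhammer \<alpha> n / fact n) * z ^ n) sums cauchy_power \<alpha> z"
proof -
  have "(\<lambda>n. (- of_real \<alpha> gchoose n) * (- z) ^ n) sums (1 + - z) powr (- of_real \<alpha>)"
    by (rule gen_binomial_complex) (use assms in simp)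
  moreover have "(- of_real \<alpha> gchoose n) * (- z) ^ n = of_real (pochhammer \<alpha> n / fact n) * z ^ n" for n
  proof -
    have "(- z) ^ n = (- 1) ^ n * z ^ n" by (rule power_minus)
    then show ?thesis
      by (simp add: gbinomial_pochhammer pochhammer_of_real flip: power_mult_distrib)
  qed
  ultimately show ?thesis by (simp add: cauchy_power_def)
qed

text \<open>The ratio of \<open>n powr (\<alpha> - 1)\<close> to \<open>pochhammer \<alpha> n / fact n\<close> is the \<open>n\<close>-th term of a sequence
with limit \<open>Gamma \<alpha>\<close>, hence bounded.\<close>

lemma pow_weight_le_pochhammer:
  fixes \<alpha> :: real
  assumes "0 < \<alpha>"
  obtains K where "0 \<le> K" "\<And>n. pow_weight (\<alpha> - 1) n \<le> K * (pochhammer \<alpha> n / fact n)"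
proof -
  have "Bseq (Gamma_series' \<alpha>)"
    using Gamma_series'_LIMSEQ by (rule convergent_imp_Bseq[OF convergentI])
  then obtain K where K: "0 < K" "\<And>n. norm (Gamma_series' \<alpha> n) \<le> K" by (auto elim: BseqE)
  have pp: "0 < pochhammer \<alpha> n" for n using assms by (rule pochhammer_pos)
  show thesis
  proof
    show "0 \<le> max 1 K" by simp
    fix n
    show "pow_weight (\<alpha> - 1) n \<le> max 1 K * (pochhammer \<alpha> n / fact n)"
    proof (cases n)
      case (Suc m)
      have "fact m * real n powr \<alpha> \<le> K * pochhammer \<alpha> n"
        using K(2)[of n] pp[of n] Suc
        by (simp add: Gamma_series'_def powr_def pos_divide_le_eq abs_of_pos divide_le_eq)
      then have "fact m * real n powr \<alpha> / fact n \<le> K * pochhammer \<alpha> n / fact n"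
        by (intro divide_right_mono) auto
      moreover have "fact m * real n powr \<alpha> / fact n = real n powr (\<alpha> - 1)"
      proof -
        have "fact n = real n * fact m" "0 < real n" using Suc by simp_all
        then show ?thesis by (simp add: powr_diff)
      qed
      ultimately have "real n powr (\<alpha> - 1) \<le> K * (pochhammer \<alpha> n / fact n)" by simp
      also have "\<dots> \<le> max 1 K * (pochhammer \<alpha> n / fact n)"
        using pp[of n] by (intro mult_right_mono) (auto simp: less_imp_le)
      finally show ?thesis using Suc by (simp add: pow_weight_def)
    qed (simp add: pow_weight_def)
  qed
qed

section \<open>The multiplier space\<close>

theorem theorem5p2:
  fixes p :: real and X :: "(nat \<Rightarrow> complex) set" and T :: "(nat \<Rightarrow> complex) topology"
  assumes "0 < p" and "p < 1"
    and "FK_space X T" and "solid X"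
    and "T \<hookrightarrow> H_disk_topology"
  shows "multipliers (taylor_seqs (weak_hardy p)) X = weighted_space X (1 / p - 1)"
proof -
  have "seq_subspace (topspace T)" "topspace T = X"
    using assms(3) unfolding FK_space_def F_space_def seq_tvs_def by blast+
  then have scale: "(\<lambda>n. c * x n) \<in> X" if "x \<in> X" for c x
    using that by (simp add: seq_subspace_def)
  have sol: "y \<in> X" if "x \<in> X" "\<And>n. norm (y n) \<le> K * norm (x n)" "0 \<le> K" for x y K
  proof -
    have "norm (y n) \<le> norm (of_real K * x n)" for n
      using that by (simp add: norm_mult)
    then show ?thesis
      by (rule assms(4)[unfolded solid_def, rule_format, OF scale[OF that(1)]])
  qed
  have w0: "0 \<le> pow_weight \<alpha> n" for \<alpha> n by (simp add: pow_weight_def)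
  show ?thesis
  proof (intro equalityI subsetI)
    fix l assume l: "l \<in> multipliers (taylor_seqs (weak_hardy p)) X"
    obtain K where K: "0 \<le> K" "\<And>n. pow_weight (1 / p - 1) n \<le> K * (pochhammer (1 / p) n / fact n)"
      using pow_weight_le_pochhammer[of "1 / p"] assms(1) by auto
    define a :: "nat \<Rightarrow> complex" where "a = (\<lambda>n. of_real (pochhammer (1 / p) n / fact n))"
    have "a \<in> taylor_seqs (weak_hardy p)"
      unfolding taylor_seqs_def a_def
      by (intro CollectI bexI[OF _ cauchy_power_in_weak_hardy] ballI cauchy_power_taylor) (use assms(1) in auto)
    then have "(\<lambda>n. l n * a n) \<in> X"
      using l by (simp add: multipliers_def)
    moreover have "norm (of_real (pow_weight (1 / p - 1) n) * l n) \<le>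
        K * norm (l n * a n)" for n
    proof -
      have "0 \<le> pochhammer (1 / p) n / fact n"
        using assms(1) by (intro divide_nonneg_pos pochhammer_nonneg) auto
      then show ?thesis
        using mult_right_mono[OF K(2)[of n] norm_ge_zero[of "l n"]] w0
        by (simp only: a_def norm_mult norm_of_real abs_of_nonneg mult_ac)
    qed
    ultimately have "(\<lambda>n. of_real (pow_weight (1 / p - 1) n) * l n) \<in> X"
      using K(1) by (rule sol)
    then show "l \<in> weighted_space X (1 / p - 1)" by (simp add: weighted_space_def)
  next
    fix l assume l: "l \<in> weighted_space X (1 / p - 1)"
    have "(\<lambda>n. l n * a n) \<in> X" if a: "a \<in> taylor_seqs (weak_hardy p)" for a
    proof -
      obtain K where K: "0 \<le> K" "\<And>n. norm (a n) \<le> K * pow_weight (1 / p - 1) n"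
        using weak_hardy_coeff_bound[OF a assms(1,2)] by blast
      have "norm (l n * a n) \<le> K * norm (of_real (pow_weight (1 / p - 1) n) * l n)" for n
        using mult_left_mono[OF K(2)[of n] norm_ge_zero[of "l n"]] w0
        by (simp add: norm_mult mult_ac)
      then show ?thesis
        using K(1) by (rule sol[OF l[unfolded weighted_space_def mem_Collect_eq]])
    qed
    then show "l \<in> multipliers (taylor_seqs (weak_hardy p)) X" by (simp add: multipliers_def)
  qed
qed

end
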